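(* Let $\mathbf{Y}=(Y_1,Y_2,Y_3)$ be a $(0,1)^3$-valued random vector with independent components, having a strictly positive, continuously differentiable density on $(0,1)^3$. Let $\Psi=\psi_2\circ\psi_1^{-1}:(0,1)^3\to(0,1)^3$, with $\psi_1,\psi_2$ as defined in the context, and suppose that the random vector $$\mathbf{Z}=(Z_1,Z_2,Z_3)=\Psi(Y_1,Y_2,Y_3)$$ also has independent components. Then there exist positive numbers $p,q,r$ such that $$\mathbf{Y}\stackrel{d}{=}\mathbf{Z}\sim B_I(p+r,q+r)\otimes B_I(p,q+r)\otimes B_I(r,q).$$
   Context: Let $H=\{(x_1,x_2,x_3)\in(0,1)^3:\ \min\{x_1x_2,\,(1-x_1)(1-x_2)\}>x_3\}$. For $i=1,2$ the map $\psi_i:H\to(0,1)^3$ is the bijection $$\psi_i(x_1,x_2,x_3)=\left(x_i,\ \frac{x_1x_2-x_3}{x_i},\ \frac{x_3}{(1-x_i)(x_i-x_1x_2+x_3)}\right).$$ Explicitly, for $(y_1,y_2,y_3)\in(0,1)^3$, $$\Psi(y_1,y_2,y_3)=\left(y_2+(1-y_1)(1-y_2)y_3,\ \frac{y_1y_2}{y_2+(1-y_1)(1-y_2)y_3},\ \frac{y_1y_3}{[1-(1-y_1)y_3][y_2+y_3(1-y_2)]}\right).$$ For $a,b>0$, $B_I(a,b)$ denotes the beta distribution on $(0,1)$ with density $x^{a-1}(1-x)^{b-1}/B(a,b)$, where $B(a,b)=\Gamma(a)\Gamma(b)/\Gamma(a+b)$. The symbol $\otimes$ denotes product measure, $\stackrel{d}{=}$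 equality in distribution, and $\sim$ means "has distribution". *)

theory Defs
  imports "HOL-Probability.Probability"
begin

fun coord :: "nat \<Rightarrow> real \<times> real \<times> real \<Rightarrow> real" where
  "coord i (x1, x2, x3) = (if i = 1 then x1 else if i = 2 then x2 else x3)"

definition cube :: "(real \<times> real \<times> real) set" where
  "cube = {0<..<1} \<times> {0<..<1} \<times> {0<..<1}"

definition Hset :: "(real \<times> real \<times> real) set" where
  "Hset = {(x1, x2, x3) \<in> cube. min (x1 * x2) ((1 - x1) * (1 - x2)) > x3}"

(* Only the indices i = 1 and i = 2 are meaningful. *)
fun psi :: "nat \<Rightarrow> real \<times> real \<times> real \<Rightarrow> real \<times> real \<times> real" where
  "psi i (x1, x2, x3) =
     (let xi = coord i (x1, x2, x3)
      in (xi, (x1 * x2 - x3) / xi, x3 / ((1 - xi) * (xi - x1 * x2 + x3))))"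

(* psi 1 is a bijection from Hset onto cube (see bij_betw_psi_1), so on cube this is the
   composition of psi 2 with the inverse of psi 1; off cube its values are irrelevant. *)
definition Psi :: "real \<times> real \<times> real \<Rightarrow> real \<times> real \<times> real" where
  "Psi = psi 2 \<circ> inv_into Hset (psi 1)"

(* To be used for open S, where differentiability at x and at x within S agree. *)
definition C1_on :: "'a::real_normed_vector set \<Rightarrow> ('a \<Rightarrow> real) \<Rightarrow> bool" where
  "C1_on S f \<longleftrightarrow>
     (\<exists>f' :: 'a \<Rightarrow> 'a \<Rightarrow>\<^sub>L real.
        (\<forall>x\<in>S. (f has_derivative blinfun_apply (f' x)) (at x)) \<and> continuous_on S f')"

definition beta_density :: "real \<Rightarrow> real \<Rightarrow> real \<Rightarrow> real" where
  "beta_density a b x =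
     (if x \<in> {0<..<1} then x powr (a - 1) * (1 - x) powr (b - 1) / Beta a b else 0)"

definition beta_measure :: "real \<Rightarrow> real \<Rightarrow> real measure" where
  "beta_measure a b = density lborel (\<lambda>x. ennreal (beta_density a b x))"

lemma psi_1_inverse:
  assumes "0 < y1" "y1 < 1" "0 < y2" "y2 < 1" "0 < y3" "y3 < (1::real)"
  shows "(y1, y2 + (1 - y1) * (1 - y2) * y3, y1 * (1 - y1) * (1 - y2) * y3) \<in> Hset"
    and "psi 1 (y1, y2 + (1 - y1) * (1 - y2) * y3, y1 * (1 - y1) * (1 - y2) * y3) = (y1, y2, y3)"
proof -
  have p: "0 < (1 - y1) * (1 - y2) * y3" "0 < y1 * (1 - y1) * (1 - y2) * y3"
    using assms by auto
  have a: "(1 - y1) * y3 < 1" using assms by (smt (verit) mult_le_cancel_left1 mult_less_cancel_right2)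
  have e: "1 - (y2 + (1 - y1) * (1 - y2) * y3) = (1 - y2) * (1 - (1 - y1) * y3)"
    by (simp add: algebra_simps)
  have q: "0 < (1 - y2) * (1 - (1 - y1) * y3)" using assms a by simp
  have r: "y1 * (1 - y1) * (1 - y2) * y3 < 1"
  proof -
    have "y1 * (1 - y1) * (1 - y2) * y3 = y1 * ((1 - y1) * (1 - y2) * y3)" by simp
    also have "\<dots> < y1 * 1" using assms p q e by (intro mult_strict_left_mono) linarith+
    finally show ?thesis using assms by linarith
  qed
  have s: "y1 * (1 - y1) * (1 - y2) * y3 < y1 * (y2 + (1 - y1) * (1 - y2) * y3)"
    using assms by (simp add: algebra_simps)
  have t: "y1 * (1 - y1) * (1 - y2) * y3 < (1 - y1) * (1 - (y2 + (1 - y1) * (1 - y2) * y3))"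
  proof -
    have "(1 - y1) * (1 - (y2 + (1 - y1) * (1 - y2) * y3)) - y1 * (1 - y1) * (1 - y2) * y3
        = (1 - y1) * (1 - y2) * (1 - y3)" by (simp add: algebra_simps)
    moreover have "0 < (1 - y1) * (1 - y2) * (1 - y3)" using assms by simp
    ultimately show ?thesis by linarith
  qed
  show "(y1, y2 + (1 - y1) * (1 - y2) * y3, y1 * (1 - y1) * (1 - y2) * y3) \<in> Hset"
    unfolding Hset_def cube_def using assms p q e r s t by auto
  have "y1 * (y2 + (1 - y1) * (1 - y2) * y3) - y1 * (1 - y1) * (1 - y2) * y3 = y1 * y2"
    by (simp add: algebra_simps)
  moreover have "(1 - y1) * (y1 - y1 * (y2 + (1 - y1) * (1 - y2) * y3) + y1 * (1 - y1) * (1 - y2) * y3)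
     = y1 * (1 - y1) * (1 - y2)"
    by (simp add: algebra_simps)
  ultimately show "psi 1 (y1, y2 + (1 - y1) * (1 - y2) * y3, y1 * (1 - y1) * (1 - y2) * y3) = (y1, y2, y3)"
    using assms by (simp add: Let_def)
qed

lemma psi_1_left_inverse:
  assumes "(x1, x2, x3) \<in> Hset"
  shows "psi 1 (x1, x2, x3) \<in> cube"
    and "psi 1 (x1, x2, x3) = (y1, y2, y3) \<Longrightarrow>
      x1 = y1 \<and> x2 = y2 + (1 - y1) * (1 - y2) * y3 \<and> x3 = y1 * (1 - y1) * (1 - y2) * y3"
proof -
  have x: "0 < x1" "x1 < 1" "0 < x2" "x2 < 1" "0 < x3" "x3 < x1 * x2" "x3 < (1 - x1) * (1 - x2)"
    using assms by (auto simp: Hset_def cube_def)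
  have d: "0 < x1 - x1 * x2 + x3"
  proof -
    have "x1 * x2 < x1 * 1" using x by (intro mult_strict_left_mono) auto
    then show ?thesis using x by linarith
  qed
  have D: "0 < (1 - x1) * (x1 - x1 * x2 + x3)" using x d by simp
  have "(1 - x1) * (x1 - x1 * x2 + x3) - x3 = x1 * ((1 - x1) * (1 - x2) - x3)"
    by (simp add: algebra_simps)
  moreover have "0 < x1 * ((1 - x1) * (1 - x2) - x3)" using x by simp
  ultimately have l: "x3 < (1 - x1) * (x1 - x1 * x2 + x3)" by linarith
  show "psi 1 (x1, x2, x3) \<in> cube"
    unfolding cube_def using x d D l by (simp add: Let_def)
  assume "psi 1 (x1, x2, x3) = (y1, y2, y3)"
  then have y: "y1 = x1" "y2 = (x1 * x2 - x3) / x1" "y3 = x3 / ((1 - x1) * (x1 - x1 * x2 + x3))"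
    by (auto simp: Let_def)
  have y2: "x1 * y2 = x1 * x2 - x3" using y x by simp
  have y3: "y3 * ((1 - x1) * (x1 - x1 * x2 + x3)) = x3" using y(3) D by (metis less_irrefl nonzero_eq_divide_eq)
  have "x1 * (1 - y2) = x1 - x1 * x2 + x3" using y2 by (simp add: algebra_simps)
  then have h: "x1 * (1 - x1) * (1 - y2) * y3 = x3"
    using y3 by (metis mult.assoc mult.commute)
  have "x1 * (y2 + (1 - x1) * (1 - y2) * y3) = x1 * y2 + x1 * (1 - x1) * (1 - y2) * y3"
    by (simp add: distrib_left mult.assoc)
  also have "\<dots> = x1 * x2" unfolding h y2 by simp
  finally have "x1 * (y2 + (1 - x1) * (1 - y2) * y3) = x1 * x2" .
  then have "y2 + (1 - x1) * (1 - y2) * y3 = x2" using x by simp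
  then show "x1 = y1 \<and> x2 = y2 + (1 - y1) * (1 - y2) * y3 \<and> x3 = y1 * (1 - y1) * (1 - y2) * y3"
    using h y(1) by simp
qed

lemma bij_betw_psi_1: "bij_betw (psi 1) Hset cube"
proof (rule bij_betw_imageI)
  show "inj_on (psi 1) Hset"
  proof (rule inj_onI)
    fix x x' assume x: "x \<in> Hset" "x' \<in> Hset" "psi 1 x = psi 1 x'"
    obtain a b c where y: "psi 1 x = (a, b, c)" by (metis prod_cases3)
    obtain x1 x2 x3 where 1: "x = (x1, x2, x3)" by (metis prod_cases3)
    obtain z1 z2 z3 where 2: "x' = (z1, z2, z3)" by (metis prod_cases3)
    from psi_1_left_inverse(2)[of x1 x2 x3 a b c] psi_1_left_inverse(2)[of z1 z2 z3 a b c]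
    show "x = x'" using x y 1 2 by metis
  qed
  show "psi 1 ` Hset = cube"
  proof
    show "psi 1 ` Hset \<subseteq> cube" using psi_1_left_inverse(1) by auto
    show "cube \<subseteq> psi 1 ` Hset"
    proof
      fix y assume "y \<in> cube"
      then obtain y1 y2 y3 where y: "y = (y1, y2, y3)"
        "0 < y1" "y1 < 1" "0 < y2" "y2 < 1" "0 < y3" "y3 < 1"
        by (auto simp: cube_def)
      from psi_1_inverse[OF y(2-)] show "y \<in> psi 1 ` Hset" unfolding y(1) by (metis imageI)
    qed
  qed
qed

lemma bij_betw_psi_2: "bij_betw (psi 2) Hset cube"
proof -
  define s :: "real \<times> real \<times> real \<Rightarrow> _" where "s = (\<lambda>(x1, x2, x3). (x2, x1, x3))"
  have "bij_betw s Hset Hset"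
    by (rule bij_betw_byWitness[where f' = s]) (auto simp: s_def Hset_def cube_def mult.commute)
  from bij_betw_trans[OF this bij_betw_psi_1] show ?thesis
    by (rule bij_betw_cong[THEN iffD1, rotated])
      (auto simp: s_def Let_def mult.commute)
qed

lemma Psi_explicit:
  assumes "0 < y1" "y1 < 1" "0 < y2" "y2 < 1" "0 < y3" "y3 < (1::real)"
  shows "Psi (y1, y2, y3) =
    (y2 + (1 - y1) * (1 - y2) * y3,
     y1 * y2 / (y2 + (1 - y1) * (1 - y2) * y3),
     y1 * y3 / ((1 - (1 - y1) * y3) * (y2 + y3 * (1 - y2))))"
proof -
  let ?x = "(y1, y2 + (1 - y1) * (1 - y2) * y3, y1 * (1 - y1) * (1 - y2) * y3)"
  have inv: "inv_into Hset (psi 1) (y1, y2, y3) = ?x"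
    using psi_1_inverse[OF assms] bij_betw_psi_1
    by (metis bij_betw_inv_into_left)
  have n: "y1 * (y2 + (1 - y1) * (1 - y2) * y3) - y1 * (1 - y1) * (1 - y2) * y3 = y1 * y2"
    by (simp add: algebra_simps)
  have d: "(1 - (y2 + (1 - y1) * (1 - y2) * y3)) *
      (y2 + (1 - y1) * (1 - y2) * y3 - y1 * (y2 + (1 - y1) * (1 - y2) * y3)
        + y1 * (1 - y1) * (1 - y2) * y3)
    = ((1 - y1) * (1 - y2)) * ((1 - (1 - y1) * y3) * (y2 + y3 * (1 - y2)))"
    by (simp add: algebra_simps)
  have t: "y1 * (1 - y1) * (1 - y2) * y3 = ((1 - y1) * (1 - y2)) * (y1 * y3)" by simp
  have nz: "(1 - y1) * (1 - y2) \<noteq> 0" using assms by simp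
  show ?thesis
    unfolding Psi_def comp_def inv using n d nz
    by (simp add: Let_def t del: mult_eq_0_iff)
qed

end

theory Submission
  imports Defs
begin

text \<open>\<^const>\<open>Psi\<close> is an involution of the cube which preserves the measure with density
  \<open>y1 (1 - y1) (1 - y2)\<close>. So both vectors having independent components means that
  \<open>a1 y1 + a2 y2 + a3 y3 = b1 z1 + b2 z2 + b3 z3\<close> for the logarithms of the (weighted) factors. Letting
  \<open>y3 \<rightarrow> 0\<close> along curves on which \<open>y3\<close> and \<open>z3\<close> are held fixed, so that \<open>z3 / y3 \<rightarrow> s / t\<close>, shows that
  \<open>a1 - b2\<close> and \<open>b1 - a2\<close> are the same multiple of the logarithm, up to constants. Letting \<open>y3 \<rightarrow> 1\<close> instead gives
  \<open>e x - e (x / (1 - y)) + \<beta> (y / (1 - x)) - \<beta> y = R ((1 - y) / (1 - x))\<close>, an equation of the type that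
  characterises entropy. Eliminating one term between its two partial derivatives, and then letting
  \<open>x \<rightarrow> 0\<close> and \<open>y \<rightarrow> 0\<close>, forces \<open>R\<close> to be a logarithm and \<open>e\<close>, \<open>\<beta>\<close> to be combinations of
  \<open>ln x\<close> and \<open>ln (1 - x)\<close>. The third factors follow because \<open>y1 y2\<close>, \<open>(1 - y1) (1 - y2) (1 - y3)\<close> and
  \<open>y1 y3 / (1 - y3)\<close> are invariants of \<^const>\<open>Psi\<close>, and integrability makes the exponents positive.\<close>

section \<open>An equation of entropy type\<close>

lemma const_if_less_const:
  fixes f :: "real \<Rightarrow> 'a"
  assumes "\<And>x y. 0 < x \<Longrightarrow> x < y \<Longrightarrow> y < 1 \<Longrightarrow> f x = f y" and "x \<in> {0<..<1}"
  shows "f x = f (1/2)"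
proof -
  consider "x < 1/2" | "1/2 < x" | "x = 1/2" by linarith
  then show ?thesis
  proof cases
    case 3 then show ?thesis by (rule arg_cong)
  qed (use assms(1)[of x "1/2"] assms(1)[of "1/2" x] assms(2) in auto)
qed

lemma const_on_unit_interval:
  fixes f :: "real \<Rightarrow> real"
  assumes "\<And>x. x \<in> {0<..<1} \<Longrightarrow> (f has_real_derivative 0) (at x)"
    and "x \<in> {0<..<1}" "y \<in> {0<..<1}"
  shows "f x = f y"
proof -
  have "\<exists>c. \<forall>x\<in>{0<..<1}. f x = c"
    by (rule has_field_derivative_zero_constant) (auto intro: has_field_derivative_at_within[OF assms(1)])
  then show ?thesis using assms(2,3) by auto
qed

text \<open>Passing from \<open>z\<close> to \<open>\<mu> * \<nu> * z\<close> in one step or in two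
  makes \<open>h\<close> a cocycle, \<open>h (\<mu> * \<nu>) = h \<mu> + \<mu> * h \<nu>\<close>.
  The left side is symmetric in \<open>\<mu>\<close> and \<open>\<nu>\<close>, hence so is the right
  side, and this determines \<open>h\<close> up to a factor.\<close>

lemma affine_if_scaling_difference:
  fixes g h :: "real \<Rightarrow> real"
  assumes gh: "\<And>z \<mu>. z \<in> {0<..<1} \<Longrightarrow> \<mu> \<in> {0<..<1} \<Longrightarrow> g z - g (\<mu> * z) = z * h \<mu>"
  obtains K d where "\<And>z. z \<in> {0<..<1} \<Longrightarrow> g z = K * z + d"
    and "\<And>\<mu>. \<mu> \<in> {0<..<1} \<Longrightarrow> h \<mu> = K * (1 - \<mu>)"
proof -
  have cocycle: "h (\<mu> * \<nu>) = h \<mu> + \<mu> * h \<nu>" if "\<mu> \<in> {0<..<1}" "\<nu> \<in> {0<..<1}" for \<mu> \<nu>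
  proof -
    have m: "\<mu> * \<nu> \<in> {0<..<1}" "\<mu> * (1/2) \<in> {0<..<1}"
      using that mult_strict_mono[of \<mu> 1 \<nu> 1] by simp_all
    have "g (1/2) - g (\<mu> * \<nu> * (1/2)) = (1/2) * h (\<mu> * \<nu>)" by (rule gh[OF _ m(1)]) auto
    moreover have "g (1/2) - g (\<mu> * (1/2)) = (1/2) * h \<mu>" by (rule gh[OF _ that(1)]) auto
    moreover have "g (\<mu> * (1/2)) - g (\<nu> * (\<mu> * (1/2))) = \<mu> * (1/2) * h \<nu>"
      using gh that m by blast
    ultimately show ?thesis by (simp add: mult.commute mult.left_commute)
  qed
  \<comment> \<open>Symmetry of the cocycle at \<open>\<nu> = 1/2\<close> reads
    \<open>h \<mu> + \<mu> * h (1/2) = h (1/2) + 1/2 * h \<mu>\<close>; solving for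
    \<open>h \<mu>\<close> produces this factor.\<close>
  define K where "K = 2 * h (1/2)"
  have hK: "h \<mu> = K * (1 - \<mu>)" if "\<mu> \<in> {0<..<1}" for \<mu>
  proof -
    have "h \<mu> + \<mu> * h (1/2) = h (1/2) + 1/2 * h \<mu>"
      using cocycle[OF that, of "1/2"] cocycle[OF _ that, of "1/2"] by (simp add: mult.commute)
    then show ?thesis by (simp add: K_def algebra_simps)
  qed
  define d where "d = g (1/2) - K * (1/2)"
  have "g z' - K * z' = g z - K * z" if "0 < z'" "z' < z" "z < 1" for z z'
  proof -
    have "z \<in> {0<..<1}" "z' / z \<in> {0<..<1}" "z' / z * z = z'" using that by auto
    then have "g z - g z' = z * (K * (1 - z' / z))"
      using gh[of z "z' / z"] hK[of "z' / z"] by metis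
    also have "\<dots> = K * z - K * z'" using that by (simp add: field_simps)
    finally show ?thesis by simp
  qed
  from const_if_less_const[of "\<lambda>z. g z - K * z", OF this]
  have "g z = K * z + (g (1/2) - K * (1/2))" if "z \<in> {0<..<1}" for z
    using that by (metis add.commute diff_eq_eq)
  from that[OF this hK] show ?thesis .
qed

lemma log_form_if_derivative:
  fixes f :: "real \<Rightarrow> real"
  assumes "\<And>x. x \<in> {0<..<1} \<Longrightarrow> (f has_real_derivative \<sigma> / x - m / (1 - x)) (at x)"
  obtains c where "\<And>x. x \<in> {0<..<1} \<Longrightarrow> f x = \<sigma> * ln x + m * ln (1 - x) + c"
proof -
  let ?g = "\<lambda>x. f x - (\<sigma> * ln x + m * ln (1 - x))"
  have "(?g has_real_derivative 0) (at x)" if "x \<in> {0<..<1}" for x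
  proof -
    have "((\<lambda>x. \<sigma> * ln x + m * ln (1 - x)) has_real_derivative \<sigma> / x - m / (1 - x)) (at x)"
      using that by (auto intro!: derivative_eq_intros simp: divide_simps)
    from DERIV_diff[OF assms[OF that] this] show ?thesis by simp
  qed
  from const_on_unit_interval[OF this, of _ "1/2"] have "?g x = ?g (1/2)" if "x \<in> {0<..<1}" for x
    using that by simp
  then have "f x = \<sigma> * ln x + m * ln (1 - x) + ?g (1/2)" if "x \<in> {0<..<1}" for x
    using that by (metis add.commute diff_eq_eq)
  from that[OF this] show ?thesis .
qed

section \<open>A two-function variant of the fundamental equation of information\<close>

text \<open>The defect in an equation like the fundamental equation of information, but without the
  weights \<open>1 - x\<close> and \<open>1 - y\<close> on the quotient terms and with two unknown
  functions. In the application the defect is a function of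
  \<open>(1 - y) / (1 - x)\<close>.\<close>

definition info :: "(real \<Rightarrow> real) \<Rightarrow> (real \<Rightarrow> real) \<Rightarrow> real \<Rightarrow> real \<Rightarrow> real" where
  "info e \<beta> x y = e x - e (x / (1 - y)) + \<beta> (y / (1 - x)) - \<beta> y"

lemma info_derivatives:
  assumes e: "\<And>x. x \<in> {0<..<1} \<Longrightarrow> (e has_real_derivative e' x) (at x)"
    and b: "\<And>x. x \<in> {0<..<1} \<Longrightarrow> (\<beta> has_real_derivative b' x) (at x)"
    and xy: "0 < x" "0 < y" "x + y < 1"
  shows "((\<lambda>x. info e \<beta> x y) has_real_derivative
           e' x - e' (x / (1 - y)) / (1 - y) + b' (y / (1 - x)) * y / (1 - x)\<^sup>2) (at x)"
    and "((\<lambda>y. info e \<beta> x y) has_real_derivative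
           - e' (x / (1 - y)) * x / (1 - y)\<^sup>2 + b' (y / (1 - x)) / (1 - x) - b' y) (at y)"
proof -
  have r: "x / (1 - y) \<in> {0<..<1}" "y / (1 - x) \<in> {0<..<1}" "x \<in> {0<..<1}" "y \<in> {0<..<1}"
    using xy by auto
  have d: "((\<lambda>x. x / (1 - y)) has_real_derivative 1 / (1 - y)) (at x)"
    "((\<lambda>x. y / (1 - x)) has_real_derivative y / (1 - x)\<^sup>2) (at x)"
    "((\<lambda>y. x / (1 - y)) has_real_derivative x / (1 - y)\<^sup>2) (at y)"
    "((\<lambda>y. y / (1 - x)) has_real_derivative 1 / (1 - x)) (at y)"
    using xy by (auto intro!: derivative_eq_intros simp: power2_eq_square)
  note dx = DERIV_chain2[where g = "\<lambda>x. x / (1 - y)", OF e[OF r(1)] d(1)]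
    DERIV_chain2[where g = "\<lambda>x. y / (1 - x)", OF b[OF r(2)] d(2)]
  note dy = DERIV_chain2[where g = "\<lambda>y. x / (1 - y)", OF e[OF r(1)] d(3)]
    DERIV_chain2[where g = "\<lambda>y. y / (1 - x)", OF b[OF r(2)] d(4)]
  show "((\<lambda>x. info e \<beta> x y) has_real_derivative
           e' x - e' (x / (1 - y)) / (1 - y) + b' (y / (1 - x)) * y / (1 - x)\<^sup>2) (at x)"
    unfolding info_def
    by (rule DERIV_cong[OF DERIV_diff[OF DERIV_add[OF DERIV_diff[OF e[OF r(3)] dx(1)] dx(2)] DERIV_const]]) simp
  show "((\<lambda>y. info e \<beta> x y) has_real_derivative
           - e' (x / (1 - y)) * x / (1 - y)\<^sup>2 + b' (y / (1 - x)) / (1 - x) - b' y) (at y)"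
    unfolding info_def
    by (rule DERIV_cong[OF DERIV_diff[OF DERIV_add[OF DERIV_diff[OF DERIV_const dy(1)] dy(2)] b[OF r(4)]]]) simp
qed

text \<open>Fix \<open>y\<close> and let \<open>x\<close> tend to 0. The terms
  \<open>(1 - y) * b' y\<close> cancel in the limit, so \<open>x * e' x\<close> tends to
  \<open>S (1 - y)\<close>. The expression \<open>x * e' x\<close> does not involve
  \<open>y\<close>, and limits are unique.\<close>

lemma ratio_function_const:
  fixes S e' b' :: "real \<Rightarrow> real"
  assumes S: "\<And>\<rho>. 0 < \<rho> \<Longrightarrow> isCont S \<rho>"
    and b': "continuous_on {0<..<1} b'"
    and eq: "\<And>x y. 0 < x \<Longrightarrow> 0 < y \<Longrightarrow> x + y < 1 \<Longrightarrow>
      (1 - x) * (x * e' x + (1 - y) * b' y)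
        = (1 - y / (1 - x)) * b' (y / (1 - x)) + S ((1 - y) / (1 - x))"
    and \<rho>: "\<rho> \<in> {0<..<1}" "\<rho>' \<in> {0<..<1}"
  shows "S \<rho> = S \<rho>'"
proof -
  have lim: "((\<lambda>x. x * e' x) \<longlongrightarrow> S (1 - y)) (at_right 0)" if y: "y \<in> {0<..<1}" for y
  proof -
    have c: "isCont b' y" using b' y by (simp add: continuous_on_eq_continuous_at)
    have q: "((\<lambda>x. y / (1 - x)) \<longlongrightarrow> y) (at_right 0)" "((\<lambda>x. (1 - y) / (1 - x)) \<longlongrightarrow> 1 - y) (at_right 0)"
      by (auto intro!: tendsto_eq_intros)
    have "((\<lambda>x. ((1 - y / (1 - x)) * b' (y / (1 - x)) + S ((1 - y) / (1 - x))) / (1 - x) - (1 - y) * b' y)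
        \<longlongrightarrow> ((1 - y) * b' y + S (1 - y)) / (1 - 0) - (1 - y) * b' y) (at_right 0)"
      using y by (intro tendsto_intros q isCont_tendsto_compose[OF c q(1)] isCont_tendsto_compose[OF S q(2)]) auto
    moreover have "\<forall>\<^sub>F x in at_right 0. ((1 - y / (1 - x)) * b' (y / (1 - x)) + S ((1 - y) / (1 - x))) / (1 - x)
        - (1 - y) * b' y = x * e' x"
    proof -
      have "\<forall>\<^sub>F x in at_right 0. 0 < x \<and> x < 1 - y"
        using y by (auto simp: eventually_at_right intro!: exI[of _ "1 - y"])
      then show ?thesis
      proof eventually_elim
        case (elim x)
        have "((1 - y / (1 - x)) * b' (y / (1 - x)) + S ((1 - y) / (1 - x))) / (1 - x)
            = x * e' x + (1 - y) * b' y"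
          using eq[of x y] elim y by (simp add: divide_eq_eq mult.commute)
        then show ?case by simp
      qed
    qed
    ultimately show ?thesis by (auto dest: tendsto_cong[THEN iffD1, rotated])
  qed
  show ?thesis
    using tendsto_unique[OF _ lim[of "1 - \<rho>"] lim[of "1 - \<rho>'"]] \<rho> by simp
qed

text \<open>By \<open>ratio\<close>, \<open>info\<close> is a function \<open>R\<close> of the
  quotient \<open>\<rho>\<close>; \<open>S \<rho>\<close> is \<open>\<rho>\<close> times the
  derivative of \<open>R\<close>. The three identities are the x-derivative of this relation and the
  two combinations of both partial derivatives from which \<open>e' (x / (1 - y))\<close>,
  respectively \<open>b' (y / (1 - x))\<close>, has been eliminated.\<close>

lemma info_ratio_function:
  assumes e: "\<And>x. x \<in> {0<..<1} \<Longrightarrow> (e has_real_derivative e' x) (at x)"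
    and b: "\<And>x. x \<in> {0<..<1} \<Longrightarrow> (\<beta> has_real_derivative b' x) (at x)"
    and b': "continuous_on {0<..<1} b'"
    and ratio: "\<And>x y x' y'. 0 < x \<Longrightarrow> 0 < y \<Longrightarrow> x + y < 1 \<Longrightarrow> 0 < x' \<Longrightarrow> 0 < y' \<Longrightarrow> x' + y' < 1 \<Longrightarrow>
      (1 - y) / (1 - x) = (1 - y') / (1 - x') \<Longrightarrow> info e \<beta> x y = info e \<beta> x' y'"
  obtains S where "\<And>\<rho>. 0 < \<rho> \<Longrightarrow> isCont S \<rho>"
    and "\<And>x y. 0 < x \<Longrightarrow> 0 < y \<Longrightarrow> x + y < 1 \<Longrightarrow>
      e' x - e' (x / (1 - y)) / (1 - y) + b' (y / (1 - x)) * y / (1 - x)\<^sup>2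
        = S ((1 - y) / (1 - x)) / (1 - x)"
    and "\<And>x y. 0 < x \<Longrightarrow> 0 < y \<Longrightarrow> x + y < 1 \<Longrightarrow>
      (1 - x) * (x * e' x + (1 - y) * b' y)
        = (1 - y / (1 - x)) * b' (y / (1 - x)) + S ((1 - y) / (1 - x))"
    and "\<And>x y. 0 < x \<Longrightarrow> 0 < y \<Longrightarrow> x + y < 1 \<Longrightarrow>
      (1 - y) * (y * b' y + (1 - x) * e' x)
        = (1 - x / (1 - y)) * e' (x / (1 - y)) + S ((1 - y) / (1 - x))"
proof -
  define N where "N = (\<lambda>\<rho>::real. 1 + \<rho> + \<rho>\<^sup>2)"
  define R where "R = (\<lambda>\<rho>. info e \<beta> (\<rho>\<^sup>2 / N \<rho>) (1 / N \<rho>))"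
  have N: "0 < N \<rho>" if "0 < \<rho>" for \<rho> using that by (simp add: N_def pos_add_strict)
  \<comment> \<open>a point \<open>(x, y)\<close> at which \<open>(1 - y) / (1 - x)\<close> takes the given value \<open>\<rho>\<close>\<close>
  have can: "0 < \<rho>\<^sup>2 / N \<rho>" "0 < 1 / N \<rho>" "\<rho>\<^sup>2 / N \<rho> + 1 / N \<rho> < 1"
    "1 - \<rho>\<^sup>2 / N \<rho> = (1 + \<rho>) / N \<rho>" "1 - 1 / N \<rho> = \<rho> * (1 + \<rho>) / N \<rho>" if "0 < \<rho>" for \<rho>
    using that N[OF that] by (simp_all add: divide_simps) (simp_all add: N_def power2_eq_square algebra_simps)
  have infoR: "info e \<beta> x y = R ((1 - y) / (1 - x))" if "0 < x" "0 < y" "x + y < 1" for x y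
  proof -
    define \<rho> where "\<rho> = (1 - y) / (1 - x)"
    have \<rho>: "0 < \<rho>" using that by (simp add: \<rho>_def)
    have "(1 - y) / (1 - x) = (1 - 1 / N \<rho>) / (1 - \<rho>\<^sup>2 / N \<rho>)"
      using N[OF \<rho>] \<rho> unfolding can(4,5)[OF \<rho>] \<rho>_def[symmetric] by simp
    from ratio[OF that can(1-3)[OF \<rho>] this] show ?thesis by (simp add: R_def \<rho>_def)
  qed
  have diffR: "(R has_real_derivative deriv R \<rho>) (at \<rho>)" if \<rho>: "0 < \<rho>" for \<rho>
  proof -
    have N': "N \<rho> \<noteq> 0" using N[OF \<rho>] by simp
    have comp: "(\<lambda>\<rho>. h (q \<rho>)) field_differentiable at \<rho>"
      if h: "\<And>x. x \<in> {0<..<1} \<Longrightarrow> (h has_real_derivative h' x) (at x)"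
        and "q \<rho> \<in> {0<..<1}" "q field_differentiable at \<rho>" for h h' q :: "real \<Rightarrow> real"
      using field_differentiable_compose[of q \<rho> h] that
      by (auto simp: comp_def field_differentiable_def)
    have Nd: "N field_differentiable at \<rho>" unfolding N_def
      by (auto simp: field_differentiable_def intro!: exI derivative_eq_intros)
    have unit: "x / (1 - y) \<in> {0<..<1}" "y / (1 - x) \<in> {0<..<1}" "x \<in> {0<..<1}" "y \<in> {0<..<1}"
      "1 - x \<noteq> 0" "1 - y \<noteq> 0" if "0 < x" "0 < y" "x + y < 1" for x y :: real
      using that by auto
    note u = unit[OF can(1-3)[OF \<rho>]]
    have "R field_differentiable at \<rho>"
      unfolding R_def info_def
      by (intro field_differentiable_add field_differentiable_diff comp[OF e] comp[OF b]
         field_differentiable_divide field_differentiable_power field_differentiable_const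
         field_differentiable_ident Nd N' u)
    then show ?thesis using field_differentiable_derivI by blast
  qed
  \<comment> \<open>The chain rule multiplies \<open>deriv R\<close> by
    \<open>(1 - y) / (1 - x)\<^sup>2\<close> and by \<open>- 1 / (1 - x)\<close>; in terms of
    \<open>S\<close> these become \<open>S / (1 - x)\<close> and
    \<open>- S / (1 - y)\<close>.\<close>
  define S where "S = (\<lambda>\<rho>. \<rho> * deriv R \<rho>)"
  have Sx: "e' x - e' (x / (1 - y)) / (1 - y) + b' (y / (1 - x)) * y / (1 - x)\<^sup>2
        = S ((1 - y) / (1 - x)) / (1 - x)" (is ?X)
   and Sy: "- e' (x / (1 - y)) * x / (1 - y)\<^sup>2 + b' (y / (1 - x)) / (1 - x) - b' y
        = - S ((1 - y) / (1 - x)) / (1 - y)" (is ?Y) if xy: "0 < x" "0 < y" "x + y < 1" for x y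
  proof -
    have p: "0 < (1 - y) / (1 - x)" using xy by (intro divide_pos_pos) auto
    have "((\<lambda>x. (1 - y) / (1 - x)) has_real_derivative (1 - y) / (1 - x)\<^sup>2) (at x)"
      using xy by (auto intro!: derivative_eq_intros simp: power2_eq_square)
    from DERIV_chain2[where g = "\<lambda>x. (1 - y) / (1 - x)", OF diffR[OF p] this]
    have "((\<lambda>x. info e \<beta> x y) has_real_derivative deriv R ((1 - y) / (1 - x)) * ((1 - y) / (1 - x)\<^sup>2)) (at x)"
      by (rule has_field_derivative_transform_within_open[where S = "{0<..<1 - y}"]) (use xy infoR in auto)
    from DERIV_unique[OF info_derivatives(1)[OF e b xy] this] show ?X
      by (simp add: S_def power2_eq_square mult.commute)
    have "((\<lambda>y. (1 - y) / (1 - x)) has_real_derivative - 1 / (1 - x)) (at y)"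
      using xy by (auto intro!: derivative_eq_intros simp: divide_simps)
    from DERIV_chain2[where g = "\<lambda>y. (1 - y) / (1 - x)", OF diffR[OF p] this]
    have "((\<lambda>y. info e \<beta> x y) has_real_derivative deriv R ((1 - y) / (1 - x)) * (- 1 / (1 - x))) (at y)"
      by (rule has_field_derivative_transform_within_open[where S = "{0<..<1 - x}"]) (use xy infoR in auto)
    from DERIV_unique[OF info_derivatives(2)[OF e b xy] this] show ?Y
      using xy by (simp add: S_def mult.commute)
  qed
  \<comment> \<open>\<open>x\<close> times the first equation minus \<open>1 - y\<close> times the
    second cancels \<open>W\<close>; the \<open>T\<close> terms add up to
    \<open>T / (1 - x)\<close>.\<close>
  have elim_e: "(1 - x) * (x * E + (1 - y) * B) = (1 - y / (1 - x)) * V + T"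
    if "E - W / (1 - y) + V * y / (1 - x)\<^sup>2 = T / (1 - x)"
      "- W * x / (1 - y)\<^sup>2 + V / (1 - x) - B = - T / (1 - y)" "x < 1" "y < 1" for x y E B V W T :: real
  proof -
    have B: "B = - W * x / (1 - y)\<^sup>2 + V / (1 - x) + T / (1 - y)"
      and E: "E = T / (1 - x) + W / (1 - y) - V * y / (1 - x)\<^sup>2" using that by (simp_all add: algebra_simps)
    show ?thesis unfolding B E using that(3,4)
      by (simp add: divide_simps power2_eq_square) (simp add: algebra_simps)
  qed
  \<comment> \<open>\<open>1 - x\<close> times the first equation minus \<open>y\<close> times the
    second cancels \<open>V\<close>; the \<open>T\<close> terms add up to
    \<open>T / (1 - y)\<close>.\<close>
  have elim_b: "(1 - y) * (y * B + (1 - x) * E) = (1 - x / (1 - y)) * W + T"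
    if "E - W / (1 - y) + V * y / (1 - x)\<^sup>2 = T / (1 - x)"
      "- W * x / (1 - y)\<^sup>2 + V / (1 - x) - B = - T / (1 - y)" "x < 1" "y < 1" for x y E B V W T :: real
  proof -
    have B: "B = - W * x / (1 - y)\<^sup>2 + V / (1 - x) + T / (1 - y)"
      and E: "E = T / (1 - x) + W / (1 - y) - V * y / (1 - x)\<^sup>2" using that by (simp_all add: algebra_simps)
    show ?thesis unfolding B E using that(3,4)
      by (simp add: divide_simps power2_eq_square) (simp add: algebra_simps)
  qed
  have eq1: "(1 - x) * (x * e' x + (1 - y) * b' y)
        = (1 - y / (1 - x)) * b' (y / (1 - x)) + S ((1 - y) / (1 - x))"
    and eq2: "(1 - y) * (y * b' y + (1 - x) * e' x)
        = (1 - x / (1 - y)) * e' (x / (1 - y)) + S ((1 - y) / (1 - x))" if "0 < x" "0 < y" "x + y < 1" for x y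
    using elim_e[OF Sx[OF that] Sy[OF that]] elim_b[OF Sx[OF that] Sy[OF that]] that by simp_all
  \<comment> \<open>Continuity is read off from \<open>eq1\<close>: for fixed \<open>x\<close> the
    choice \<open>y = 1 - r * (1 - x)\<close> has quotient \<open>r\<close>, so \<open>S r\<close>
    is expressed near \<open>\<rho>\<close> through the continuous \<open>b'\<close>.\<close>
  have contS: "isCont S \<rho>" if \<rho>: "0 < \<rho>" for \<rho>
  proof -
    define x where "x = \<rho>\<^sup>2 / N \<rho>"
    define Y where "Y = (\<lambda>r. 1 - r * (1 - x))"
    have x: "0 < x" "x < 1" unfolding x_def using can[OF \<rho>] by linarith+
    have Y0: "Y \<rho> = 1 / N \<rho>"
      unfolding Y_def x_def can(4)[OF \<rho>] times_divide_eq_right using can(5)[OF \<rho>] by linarith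
    have "0 < Y \<rho>" "x + Y \<rho> < 1" unfolding Y0 x_def by (fact can[OF \<rho>])+
    moreover have cY: "isCont Y r" for r unfolding Y_def by (intro continuous_intros)
    moreover have tY: "(Y \<longlongrightarrow> Y \<rho>) (nhds \<rho>)"
      using cY[of \<rho>] by (simp add: isCont_def tendsto_at_iff_tendsto_nhds)
    ultimately have ev: "\<forall>\<^sub>F r in nhds \<rho>. 0 < Y r \<and> Y r < 1 - x"
      by (intro eventually_conj order_tendstoD(1)[OF tY] order_tendstoD(2)[OF tY]) auto
    have cb: "isCont b' y" if "y \<in> {0<..<1}" for y
      using b' that by (simp add: continuous_on_eq_continuous_at)
    have cb1: "isCont (\<lambda>r. b' (Y r)) \<rho>"
      by (rule isCont_o2[OF cY cb]) (use \<open>0 < Y \<rho>\<close> \<open>x + Y \<rho> < 1\<close> x in auto)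
    have cb2: "isCont (\<lambda>r. b' (Y r / (1 - x))) \<rho>"
      by (rule isCont_o2[OF _ cb]) (use cY \<open>0 < Y \<rho>\<close> \<open>x + Y \<rho> < 1\<close> x in \<open>auto intro!: continuous_intros\<close>)
    have "isCont (\<lambda>r. (1 - x) * (x * e' x + (1 - Y r) * b' (Y r)) - (1 - Y r / (1 - x)) * b' (Y r / (1 - x))) \<rho>"
      using x by (intro continuous_intros cY cb1 cb2) auto
    moreover have "\<forall>\<^sub>F r in nhds \<rho>. S r =
        (1 - x) * (x * e' x + (1 - Y r) * b' (Y r)) - (1 - Y r / (1 - x)) * b' (Y r / (1 - x))"
      using ev
    proof eventually_elim
      case (elim r)
      have "(1 - Y r) / (1 - x) = r" using x by (simp add: Y_def)
      then show ?case using eq1[of x "Y r"] elim x by simp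
    qed
    ultimately show ?thesis by (simp add: isCont_cong)
  qed
  show ?thesis by (rule that[of S]) (use contS Sx eq1 eq2 in auto)
qed

text \<open>Once \<open>S\<close> is known to be a constant \<open>\<sigma>\<close>, a substitution
  turns \<open>eq1\<close> into a scaling difference equation. This makes \<open>e'\<close> and
  \<open>b'\<close> rational with poles only at 0 and 1, and partial fractions give the
  logarithms.\<close>

lemma info_solution:
  assumes e: "\<And>x. x \<in> {0<..<1} \<Longrightarrow> (e has_real_derivative e' x) (at x)"
    and b: "\<And>x. x \<in> {0<..<1} \<Longrightarrow> (\<beta> has_real_derivative b' x) (at x)"
    and e': "continuous_on {0<..<1} e'" and b': "continuous_on {0<..<1} b'"
    and ratio: "\<And>x y x' y'. 0 < x \<Longrightarrow> 0 < y \<Longrightarrow> x + y < 1 \<Longrightarrow> 0 < x' \<Longrightarrow> 0 < y' \<Longrightarrow> x' + y' < 1 \<Longrightarrow>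
      (1 - y) / (1 - x) = (1 - y') / (1 - x') \<Longrightarrow> info e \<beta> x y = info e \<beta> x' y'"
  obtains \<sigma> m ce cb where "\<And>x. x \<in> {0<..<1} \<Longrightarrow> e x = \<sigma> * ln x + m * ln (1 - x) + ce"
    and "\<And>x. x \<in> {0<..<1} \<Longrightarrow> \<beta> x = \<sigma> * ln x + m * ln (1 - x) + cb"
proof -
  obtain S where S: "\<And>\<rho>. 0 < \<rho> \<Longrightarrow> isCont S \<rho>"
    and Sx: "\<And>x y. 0 < x \<Longrightarrow> 0 < y \<Longrightarrow> x + y < 1 \<Longrightarrow>
      e' x - e' (x / (1 - y)) / (1 - y) + b' (y / (1 - x)) * y / (1 - x)\<^sup>2
        = S ((1 - y) / (1 - x)) / (1 - x)"
    and eq1: "\<And>x y. 0 < x \<Longrightarrow> 0 < y \<Longrightarrow> x + y < 1 \<Longrightarrow>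
      (1 - x) * (x * e' x + (1 - y) * b' y)
        = (1 - y / (1 - x)) * b' (y / (1 - x)) + S ((1 - y) / (1 - x))"
    and eq2: "\<And>x y. 0 < x \<Longrightarrow> 0 < y \<Longrightarrow> x + y < 1 \<Longrightarrow>
      (1 - y) * (y * b' y + (1 - x) * e' x)
        = (1 - x / (1 - y)) * e' (x / (1 - y)) + S ((1 - y) / (1 - x))"
    by (rule info_ratio_function[OF e b b' ratio]) (assumption+, blast)
  define \<sigma> where "\<sigma> = S 1"
  have below: "S \<rho> = S \<rho>'" if "\<rho> \<in> {0<..<1}" "\<rho>' \<in> {0<..<1}" for \<rho> \<rho>'
    by (rule ratio_function_const[OF S b' eq1 that])
  \<comment> \<open>Exchanging \<open>x\<close> with \<open>y\<close> and \<open>e'\<close> with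
    \<open>b'\<close> turns \<open>eq2\<close> into the equation \<open>eq1\<close> for
    \<open>S (inverse \<rho>)\<close>, so the same limit treats quotients above 1.\<close>
  have above: "S (inverse \<rho>) = S (inverse \<rho>')" if "\<rho> \<in> {0<..<1}" "\<rho>' \<in> {0<..<1}" for \<rho> \<rho>'
    by (rule ratio_function_const[OF _ e' _ that, where e' = b'])
      (use eq2 in \<open>auto intro!: isCont_o2[OF _ S] continuous_intros simp: add.commute\<close>)
  \<comment> \<open>Continuity at 1 joins the constant values on the two sides of 1.\<close>
  have S1: "S \<rho> = \<sigma>" if "0 < \<rho>" for \<rho>
  proof -
    have l: "(S \<longlongrightarrow> \<sigma>) (at_left 1)" and r: "(S \<longlongrightarrow> \<sigma>) (at_right 1)"
      using S[of 1] by (auto simp: \<sigma>_def isCont_def filterlim_at_split)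
    have l': "(S \<longlongrightarrow> S (1/2)) (at_left 1)"
      by (intro tendsto_eventually eventually_mono[OF eventually_at_left_real[of 0]]) (auto intro: below)
    have r': "(S \<longlongrightarrow> S 2) (at_right 1)"
    proof (intro tendsto_eventually eventually_mono[OF eventually_at_right_real[of 1 2]])
      fix y :: real assume "y \<in> {1<..<2}"
      then show "S y = S 2" using above[of "inverse y" "1/2"] by (simp add: field_simps)
    qed simp
    have h: "S (1/2) = \<sigma>" "S 2 = \<sigma>"
      by (rule tendsto_unique[OF _ l' l], simp) (rule tendsto_unique[OF _ r' r], simp)
    show ?thesis
    proof (cases \<rho> "1::real" rule: linorder_cases)
      case less then show ?thesis using below[of \<rho> "1/2"] h that by simp
    next
      case greater then show ?thesis using above[of "inverse \<rho>" "1/2"] h by (simp add: field_simps)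
    qed (simp add: \<sigma>_def)
  qed
  \<comment> \<open>Put \<open>x = 1 - \<mu>\<close> and \<open>y = \<mu> * z\<close> in
    \<open>eq1\<close>, so that \<open>y / (1 - x) = z\<close>. After multiplication by
    \<open>z\<close> it says that \<open>z * ((1 - z) * b' z)\<close> has scaling differences
    \<open>z * h \<mu>\<close>.\<close>
  define h where "h \<mu> = (1 - \<mu>) * e' (1 - \<mu>) * \<mu> - \<sigma>" for \<mu>
  have "z * ((1 - z) * b' z) - \<mu> * z * ((1 - \<mu> * z) * b' (\<mu> * z)) = z * h \<mu>"
    if "z \<in> {0<..<1}" "\<mu> \<in> {0<..<1}" for z \<mu>
  proof -
    have "\<mu> * z < \<mu>" using that by simp
    then have "\<mu> * ((1 - \<mu>) * e' (1 - \<mu>) + (1 - \<mu> * z) * b' (\<mu> * z)) = (1 - z) * b' z + \<sigma>"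
      using eq1[of "1 - \<mu>" "\<mu> * z"] S1[of "(1 - \<mu> * z) / \<mu>"] that by simp
    from arg_cong[OF this, of "\<lambda>t. z * t"] show ?thesis by (simp add: h_def algebra_simps)
  qed
  from affine_if_scaling_difference[of "\<lambda>z. z * ((1 - z) * b' z)" h, OF this]
  obtain K d where g: "\<And>z. z \<in> {0<..<1} \<Longrightarrow> z * ((1 - z) * b' z) = K * z + d"
    and h: "\<And>\<mu>. \<mu> \<in> {0<..<1} \<Longrightarrow> h \<mu> = K * (1 - \<mu>)"
    by blast
  have bd: "b' z = (K * z + d) / (z * (1 - z))" if "z \<in> {0<..<1}" for z
    using g[OF that] that by (simp add: field_simps)
  have ed: "e' z = (K * z + \<sigma>) / (z * (1 - z))" if "z \<in> {0<..<1}" for z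
    using h[of "1 - z"] that by (simp add: h_def field_simps)
  \<comment> \<open>One sample point, with quotient 1, links \<open>d\<close> to
    \<open>\<sigma>\<close>: there \<open>K\<close> cancels and \<open>b'\<close> occurs only
    once.\<close>
  have d: "d = \<sigma>"
    using Sx[of "1/4" "1/4"] S1[of 1]
    by (simp add: bd ed power2_eq_square add_divide_distrib diff_divide_distrib)
  have partial_fractions: "(K * z + \<sigma>) / (z * (1 - z)) = \<sigma> / z - (- \<sigma> - K) / (1 - z)"
    if "z \<in> {0<..<1}" for z
    using that by (simp add: divide_simps) (simp add: algebra_simps)
  have "(e has_real_derivative \<sigma> / x - (- \<sigma> - K) / (1 - x)) (at x)" if "x \<in> {0<..<1}" for x
    using e[OF that] unfolding ed[OF that] partial_fractions[OF that] .
  from log_form_if_derivative[OF this]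
  obtain ce where ce: "\<And>x. x \<in> {0<..<1} \<Longrightarrow> e x = \<sigma> * ln x + (- \<sigma> - K) * ln (1 - x) + ce" by blast
  have "(\<beta> has_real_derivative \<sigma> / x - (- \<sigma> - K) / (1 - x)) (at x)" if "x \<in> {0<..<1}" for x
    using b[OF that] unfolding bd[OF that] d partial_fractions[OF that] .
  from log_form_if_derivative[OF this]
  obtain cb where cb: "\<And>x. x \<in> {0<..<1} \<Longrightarrow> \<beta> x = \<sigma> * ln x + (- \<sigma> - K) * ln (1 - x) + cb" by blast
  show ?thesis by (rule that[OF ce cb])
qed

section \<open>The functional equation for the factors\<close>

definition Psi1 :: "real \<Rightarrow> real \<Rightarrow> real \<Rightarrow> real" where
  "Psi1 y1 y2 y3 = y2 + (1 - y1) * (1 - y2) * y3"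

definition Psi2 :: "real \<Rightarrow> real \<Rightarrow> real \<Rightarrow> real" where
  "Psi2 y1 y2 y3 = y1 * y2 / Psi1 y1 y2 y3"

definition Psi3 :: "real \<Rightarrow> real \<Rightarrow> real \<Rightarrow> real" where
  "Psi3 y1 y2 y3 = y1 * y3 / ((1 - (1 - y1) * y3) * (y2 + y3 * (1 - y2)))"

text \<open>The closed interval for \<open>y3\<close> matters: the limits below evaluate the
  components at \<open>y3 = 0\<close> and \<open>y3 = 1\<close>.\<close>

lemma denominators_pos:
  fixes y1 y2 y3 :: real
  assumes "y1 \<in> {0<..<1}" "y2 \<in> {0<..<1}" "y3 \<in> {0..1}"
  shows "0 < 1 - (1 - y1) * y3" "0 < y2 + y3 * (1 - y2)"
proof -
  have "(1 - y1) * y3 \<le> 1 - y1" by (rule mult_left_le) (use assms in auto)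
  moreover have "0 < y1" using assms by simp
  ultimately show "0 < 1 - (1 - y1) * y3" by linarith
  have "0 \<le> y3 * (1 - y2)" "0 < y2" using assms by simp_all
  then show "0 < y2 + y3 * (1 - y2)" by linarith
qed

lemma Psi12_range:
  assumes "y1 \<in> {0<..<1}" "y2 \<in> {0<..<1}" "y3 \<in> {0..1}"
  shows "Psi1 y1 y2 y3 \<in> {0<..<1}" "Psi2 y1 y2 y3 \<in> {0<..<1}"
proof -
  have "0 \<le> (1 - y1) * (1 - y2) * y3" using assms by auto
  moreover have "1 - Psi1 y1 y2 y3 = (1 - y2) * (1 - (1 - y1) * y3)"
    by (simp add: Psi1_def algebra_simps)
  moreover have "0 < (1 - y2) * (1 - (1 - y1) * y3)"
    using denominators_pos[OF assms] assms by simp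
  ultimately have Psi1: "y2 \<le> Psi1 y1 y2 y3" "Psi1 y1 y2 y3 < 1" by (simp_all add: Psi1_def)
  then show "Psi1 y1 y2 y3 \<in> {0<..<1}" using assms by auto
  have "y1 * y2 < 1 * y2" using assms by (intro mult_strict_right_mono) auto
  then have "y1 * y2 < Psi1 y1 y2 y3" using Psi1 by linarith
  then show "Psi2 y1 y2 y3 \<in> {0<..<1}" using assms Psi1 by (auto simp: Psi2_def)
qed

lemma one_minus_Psi3:
  assumes "y1 \<in> {0<..<1}" "y2 \<in> {0<..<1}" "y3 \<in> {0..1}"
  shows "1 - Psi3 y1 y2 y3 = (1 - y3) * Psi1 y1 y2 y3 / ((1 - (1 - y1) * y3) * (y2 + y3 * (1 - y2)))"
proof -
  have "(1 - y3) * Psi1 y1 y2 y3 = (1 - (1 - y1) * y3) * (y2 + y3 * (1 - y2)) - y1 * y3"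
    by (simp add: Psi1_def algebra_simps)
  then show ?thesis using denominators_pos[OF assms] by (simp add: Psi3_def diff_divide_distrib)
qed

lemma Psi3_range:
  assumes "y1 \<in> {0<..<1}" "y2 \<in> {0<..<1}" "y3 \<in> {0<..<1}"
  shows "Psi3 y1 y2 y3 \<in> {0<..<1}"
proof -
  have y3: "y3 \<in> {0..1}" using assms by auto
  note d = denominators_pos[OF assms(1,2) y3]
  have "0 < 1 - Psi3 y1 y2 y3"
    unfolding one_minus_Psi3[OF assms(1,2) y3] using d assms Psi12_range[OF assms(1,2) y3] by simp
  moreover have "0 < Psi3 y1 y2 y3" using d assms by (simp add: Psi3_def)
  ultimately show ?thesis by simp
qed

text \<open>If \<open>(x1, x2, x3)\<close> is the preimage of \<open>(y1, y2, y3)\<close> under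
  \<open>psi 1\<close>, the right-hand sides are \<open>x1 * x2 - x3\<close>,
  \<open>(1 - x1) * (1 - x2) - x3\<close> and the quotient of \<open>x3\<close> by the latter. All
  are symmetric in \<open>x1\<close> and \<open>x2\<close>, which \<open>Psi\<close> exchanges. The
  proof checks them by factoring the complements of the components.\<close>

lemma Psi_invariants:
  assumes "y1 \<in> {0<..<1}" "y2 \<in> {0<..<1}" "y3 \<in> {0<..<1}"
  shows "Psi1 y1 y2 y3 * Psi2 y1 y2 y3 = y1 * y2"
    and "(1 - Psi1 y1 y2 y3) * (1 - Psi2 y1 y2 y3) * (1 - Psi3 y1 y2 y3) = (1 - y1) * (1 - y2) * (1 - y3)"
    and "Psi1 y1 y2 y3 * Psi3 y1 y2 y3 / (1 - Psi3 y1 y2 y3) = y1 * y3 / (1 - y3)"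
proof -
  have y3: "y3 \<in> {0..1}" using assms by auto
  note d = denominators_pos[OF assms(1,2) y3] and Z = Psi12_range(1)[OF assms(1,2) y3]
  show "Psi1 y1 y2 y3 * Psi2 y1 y2 y3 = y1 * y2" using Z by (simp add: Psi2_def)
  have c: "1 - Psi1 y1 y2 y3 = (1 - y2) * (1 - (1 - y1) * y3)" by (simp add: Psi1_def algebra_simps)
  have "1 - Psi2 y1 y2 y3 = (Psi1 y1 y2 y3 - y1 * y2) / Psi1 y1 y2 y3" using Z by (simp add: Psi2_def diff_divide_distrib)
  also have "Psi1 y1 y2 y3 - y1 * y2 = (1 - y1) * (y2 + y3 * (1 - y2))" by (simp add: Psi1_def algebra_simps)
  finally have c2: "1 - Psi2 y1 y2 y3 = (1 - y1) * (y2 + y3 * (1 - y2)) / Psi1 y1 y2 y3" .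
  show "(1 - Psi1 y1 y2 y3) * (1 - Psi2 y1 y2 y3) * (1 - Psi3 y1 y2 y3) = (1 - y1) * (1 - y2) * (1 - y3)"
  proof -
    have "u * a * (v * b / z) * (w * z / (a * b)) = v * u * w"
      if "a \<noteq> 0" "b \<noteq> 0" "z \<noteq> 0" for a b u v w z :: real
      using that by simp
    then show ?thesis unfolding one_minus_Psi3[OF assms(1,2) y3] c c2 using d Z by force
  qed
  show "Psi1 y1 y2 y3 * Psi3 y1 y2 y3 / (1 - Psi3 y1 y2 y3) = y1 * y3 / (1 - y3)"
    unfolding one_minus_Psi3[OF assms(1,2) y3] unfolding Psi3_def using d Z assms by simp
qed

section \<open>Level sets and range of the third component\<close>

text \<open>The solution \<open>t'\<close> of \<open>Psi3 s' t' \<epsilon> = Psi3 s t \<epsilon>\<close>, in a form that still makes sense in the limits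
  \<open>\<epsilon> = 0\<close> and \<open>\<epsilon> = 1\<close>.\<close>

definition level :: "real \<Rightarrow> real \<Rightarrow> real \<Rightarrow> real \<Rightarrow> real" where
  "level s t s' \<epsilon> = 1 - (s - s' + s' * (1 - (1 - s) * \<epsilon>) * (1 - t)) / (s * (1 - (1 - s') * \<epsilon>))"

lemma Psi3_level:
  assumes "s \<in> {0<..<1}" "t \<in> {0<..<1}" "s' \<in> {0<..<1}" "\<epsilon> \<in> {0<..<1}"
  shows "Psi3 s' (level s t s' \<epsilon>) \<epsilon> = Psi3 s t \<epsilon>"
proof -
  have \<epsilon>: "\<epsilon> \<in> {0..1}" using assms by auto
  note d = denominators_pos[OF assms(1,2) \<epsilon>] denominators_pos[OF assms(3,2) \<epsilon>]
  \<comment> \<open>This is the second denominator factor of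
    \<open>Psi3 s' (level s t s' \<epsilon>) \<epsilon>\<close>. It is rescaled exactly so as to
    compensate the change from \<open>s\<close> to \<open>s'\<close> in the numerator and in the
    first denominator factor.\<close>
  have "1 - (1 - level s t s' \<epsilon>) * (1 - \<epsilon>)
      = s' * (1 - (1 - s) * \<epsilon>) * (t + \<epsilon> * (1 - t)) / (s * (1 - (1 - s') * \<epsilon>))"
    unfolding level_def using d assms by (simp add: divide_simps) (simp add: algebra_simps)
  then have "level s t s' \<epsilon> + \<epsilon> * (1 - level s t s' \<epsilon>)
      = s' * (1 - (1 - s) * \<epsilon>) * (t + \<epsilon> * (1 - t)) / (s * (1 - (1 - s') * \<epsilon>))"
    by (simp add: algebra_simps)
  then show ?thesis unfolding Psi3_def using d assms by simp
qed

text \<open>This makes the third coordinates before and after the map independent variables, which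
  later separates the third factors. The first denominator factor of \<open>Psi3\<close> is taken as
  a parameter \<open>D\<close>; it determines \<open>y1\<close>, and then \<open>\<zeta>\<close>
  determines \<open>y2\<close>.\<close>

lemma Psi3_surj:
  assumes "\<epsilon> \<in> {0<..<1}" "\<zeta> \<in> {0<..<1}"
  obtains y1 y2 where "y1 \<in> {0<..<1}" "y2 \<in> {0<..<1}" "Psi3 y1 y2 \<epsilon> = \<zeta>"
proof -
  define \<delta> where "\<delta> = 1 - \<epsilon>"
  define \<eta> where "\<eta> = 1 - \<zeta>"
  have d: "0 < \<delta>" "\<delta> < 1" "0 < \<eta>" "\<eta> < 1" using assms by (auto simp: \<delta>_def \<eta>_def)
  have c: "0 < (1 - \<delta>) * (1 - \<eta>)" "0 < \<delta> * (1 - \<eta>)" "0 < \<eta> * (1 - \<delta>)" using d by simp_all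
  define w where "w = \<delta> + \<eta> - \<delta> * \<eta>"
  have w: "\<eta> < w" "\<delta> < w" "w < 1" using c by (auto simp: w_def algebra_simps)
  then have w0: "0 < w" using d by linarith
  \<comment> \<open>The conditions \<open>0 < y1\<close>, \<open>0 < y2\<close>,
    \<open>y1 < 1\<close>, \<open>y2 < 1\<close> translate in this order to
    \<open>\<delta> < D\<close>, \<open>\<delta> < D * w\<close>, \<open>D < 1\<close>,
    \<open>D * \<eta> < \<delta>\<close>, so a \<open>D\<close> is needed between these
    bounds.\<close>
  have "max \<delta> (\<delta> / w) < min 1 (\<delta> / \<eta>)"
    using d w w0 by (auto simp: field_simps)
  then obtain D where D: "max \<delta> (\<delta> / w) < D" "D < min 1 (\<delta> / \<eta>)" using dense by blast
  then have D': "\<delta> < D" "\<delta> < D * w" "D < 1" "D * \<eta> < \<delta>" using d w0 by (auto simp: field_simps)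
  define y1 where "y1 = (D - \<delta>) / (1 - \<delta>)"
  define y2 where "y2 = 1 - (\<delta> - \<eta> * D) / (\<delta> * (1 - \<eta>) * D)"
  have D0: "0 < D" using D' d by linarith
  have y1: "y1 \<in> {0<..<1}" using D' d by (auto simp: y1_def field_simps)
  have "\<delta> - \<eta> * D < \<delta> * (1 - \<eta>) * D" using D'(2) by (simp add: w_def algebra_simps)
  then have y2: "y2 \<in> {0<..<1}" using D' d D0 by (auto simp: y2_def field_simps)
  have e1: "1 - (1 - y1) * \<epsilon> = D"
    using d by (simp add: y1_def \<delta>_def field_simps)
  have "y2 + \<epsilon> * (1 - y2) = 1 - (1 - y2) * \<delta>" by (simp add: \<delta>_def algebra_simps)
  also have "\<dots> = (D - \<delta>) / ((1 - \<eta>) * D)"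
    using d D0 by (simp add: y2_def field_simps)
  finally have e2: "y2 + \<epsilon> * (1 - y2) = (D - \<delta>) / ((1 - \<eta>) * D)" .
  have "y1 * \<epsilon> = D - \<delta>" using assms by (simp add: y1_def \<delta>_def)
  then have "Psi3 y1 y2 \<epsilon> = \<zeta>"
    unfolding Psi3_def e1 e2 using D' d D0 by (simp add: \<eta>_def)
  with y1 y2 show ?thesis using that by blast
qed

text \<open>Exchanging \<open>x1\<close> and \<open>x2\<close> twice changes nothing. In components
  only the first one has to be computed; the other two follow from the first two invariants.\<close>

lemma Psi_involution:
  assumes "y1 \<in> {0<..<1}" "y2 \<in> {0<..<1}" "y3 \<in> {0<..<1}"
  defines "z1 \<equiv> Psi1 y1 y2 y3" and "z2 \<equiv> Psi2 y1 y2 y3" and "z3 \<equiv> Psi3 y1 y2 y3"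
  shows "Psi1 z1 z2 z3 = y1" "Psi2 z1 z2 z3 = y2" "Psi3 z1 z2 z3 = y3"
proof -
  have y3: "y3 \<in> {0..1}" using assms by auto
  note d = denominators_pos[OF assms(1,2) y3]
  have z: "z1 \<in> {0<..<1}" "z2 \<in> {0<..<1}" "z3 \<in> {0<..<1}"
    unfolding z1_def z2_def z3_def using Psi12_range[OF assms(1,2) y3] Psi3_range[OF assms(1-3)] by auto
  have c: "1 - z1 = (1 - y2) * (1 - (1 - y1) * y3)" by (simp add: z1_def Psi1_def algebra_simps)
  have "z1 - y1 * y2 = (1 - y1) * (y2 + y3 * (1 - y2))" by (simp add: z1_def Psi1_def algebra_simps)
  then have "(1 - z1) * (1 - z2) * z3 = (1 - y1) * (1 - y2) * y1 * y3 / z1"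
  proof -
    assume e: "z1 - y1 * y2 = (1 - y1) * (y2 + y3 * (1 - y2))"
    have "z1 * (1 - z2) = (1 - y1) * (y2 + y3 * (1 - y2))"
      unfolding e[symmetric] using z by (simp add: z2_def Psi2_def z1_def algebra_simps)
    then have c2: "1 - z2 = (1 - y1) * (y2 + y3 * (1 - y2)) / z1" using z by (simp add: field_simps)
    show ?thesis unfolding c c2 unfolding z3_def Psi3_def using d by simp
  qed
  moreover have "z2 = y1 * y2 / z1" by (simp add: z2_def Psi2_def z1_def)
  ultimately have "Psi1 z1 z2 z3 = y1 * y2 / z1 + (1 - y1) * (1 - y2) * y1 * y3 / z1"
    by (simp only: Psi1_def[of z1])
  also have "\<dots> = y1 * (y2 + (1 - y1) * (1 - y2) * y3) / z1"
    unfolding add_divide_distrib[symmetric] by (simp add: algebra_simps)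
  also have "\<dots> = y1" using z by (simp add: z1_def Psi1_def)
  finally show 1: "Psi1 z1 z2 z3 = y1" .
  show 2: "Psi2 z1 z2 z3 = y2"
    using Psi_invariants(1)[OF z] Psi_invariants(1)[OF assms(1-3)] assms(1)
    unfolding 1 z1_def[symmetric] z2_def[symmetric] by simp
  have "(1 - y1) * (1 - y2) * (1 - Psi3 z1 z2 z3) = (1 - y1) * (1 - y2) * (1 - y3)"
    using Psi_invariants(2)[OF z] Psi_invariants(2)[OF assms(1-3)]
    unfolding 1 2 z1_def[symmetric] z2_def[symmetric] z3_def[symmetric] by simp
  then show "Psi3 z1 z2 z3 = y3" using assms(1,2) by simp
qed

section \<open>Solving the additive equation for the logarithms of the factors\<close>

text \<open>The functions stand for the logarithms of the one-dimensional factors of the densities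
  of \<open>Y\<close> and \<open>Z\<close>, taken relative to the invariant measure; this is why
  \<open>factor_eq\<close> has no Jacobian term.\<close>

locale factor_equation =
  fixes a1 a2 a3 b1 b2 b3 a1' a2' :: "real \<Rightarrow> real"
  assumes a1: "\<And>x. x \<in> {0<..<1} \<Longrightarrow> (a1 has_real_derivative a1' x) (at x)"
    and a2: "\<And>x. x \<in> {0<..<1} \<Longrightarrow> (a2 has_real_derivative a2' x) (at x)"
    and a3: "\<And>x. x \<in> {0<..<1} \<Longrightarrow> a3 field_differentiable at x"
    and a1': "continuous_on {0<..<1} a1'"
    and a2': "continuous_on {0<..<1} a2'"
    and factor_eq: "\<And>y1 y2 y3. y1 \<in> {0<..<1} \<Longrightarrow> y2 \<in> {0<..<1} \<Longrightarrow> y3 \<in> {0<..<1} \<Longrightarrow>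
      a1 y1 + a2 y2 + a3 y3 = b1 (Psi1 y1 y2 y3) + b2 (Psi2 y1 y2 y3) + b3 (Psi3 y1 y2 y3)"
begin

lemma factor_eq_inverse:
  assumes "y1 \<in> {0<..<1}" "y2 \<in> {0<..<1}" "y3 \<in> {0<..<1}"
  shows "b1 y1 + b2 y2 + b3 y3 = a1 (Psi1 y1 y2 y3) + a2 (Psi2 y1 y2 y3) + a3 (Psi3 y1 y2 y3)"
  using factor_eq[of "Psi1 y1 y2 y3" "Psi2 y1 y2 y3" "Psi3 y1 y2 y3"] Psi_involution[OF assms]
    Psi12_range[OF assms(1,2)] Psi3_range[OF assms] assms(3) by simp

text \<open>Since the map is an involution, the equation can be read backwards. With all arguments
  but one frozen at 1/2, it expresses \<open>b1\<close> or \<open>b2\<close> through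
  \<open>a1\<close>, \<open>a2\<close>, \<open>a3\<close> composed with rational functions.\<close>

lemma b_differentiable:
  assumes x: "x \<in> {0<..<1}"
  shows "b1 field_differentiable at x" "b2 field_differentiable at x"
proof -
  have comp: "(\<lambda>x. h (q x)) field_differentiable at x"
    if "h field_differentiable at (q x)" "q field_differentiable at x" for h q :: "real \<Rightarrow> real"
    using field_differentiable_compose[of q x h] that by (auto simp: comp_def)
  have transform: "g field_differentiable at x"
    if "f field_differentiable at x" "\<And>y. y \<in> {0<..<1} \<Longrightarrow> f y = g y" for f g :: "real \<Rightarrow> real"
  proof -
    have "(f has_real_derivative deriv f x) (at x)"
      using that(1) field_differentiable_derivI by blast
    from has_field_derivative_transform_within_open[OF this _ x that(2)]
    have "(g has_real_derivative deriv f x) (at x)" by simp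
    then show ?thesis unfolding field_differentiable_def by blast
  qed
  have a: "a1 field_differentiable at x" "a2 field_differentiable at x" if "x \<in> {0<..<1}" for x
    using a1[OF that] a2[OF that] field_differentiable_def by blast+
  have h: "(1/2::real) \<in> {0<..<1}" "(1/2::real) \<in> {0..1}" by auto
  have z1: "(\<lambda>x. Psi1 x (1/2) (1/2)) field_differentiable at x"
    unfolding Psi1_def by (intro field_differentiable_add field_differentiable_diff field_differentiable_mult
        field_differentiable_const field_differentiable_ident)
  moreover have "(\<lambda>x. Psi2 x (1/2) (1/2)) field_differentiable at x"
    unfolding Psi2_def using Psi12_range(1)[OF x h(1) h(2)]
    by (intro field_differentiable_divide field_differentiable_mult field_differentiable_const
        field_differentiable_ident z1) simp
  moreover have "(\<lambda>x. Psi3 x (1/2) (1/2)) field_differentiable at x"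
    unfolding Psi3_def using denominators_pos[OF x h(1) h(2), THEN less_imp_neq, THEN not_sym]
    by (intro no_zero_divisors field_differentiable_add field_differentiable_diff field_differentiable_mult
        field_differentiable_divide field_differentiable_const field_differentiable_ident) (assumption | simp)+
  ultimately have "(\<lambda>x. a1 (Psi1 x (1/2) (1/2)) + a2 (Psi2 x (1/2) (1/2)) + a3 (Psi3 x (1/2) (1/2))
      - b2 (1/2) - b3 (1/2)) field_differentiable at x"
    using Psi12_range[OF x h(1) h(2)] Psi3_range[OF x h(1) h(1)]
    by (intro field_differentiable_add field_differentiable_diff field_differentiable_const
        comp[of a1] comp[of a2] comp[of a3] a a3) assumption+
  then show "b1 field_differentiable at x"
    by (rule transform)
      (use x h factor_eq_inverse[of _ "1/2" "1/2"] in \<open>auto simp: algebra_simps\<close>)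
  have z1: "(\<lambda>x. Psi1 (1/2) x (1/2)) field_differentiable at x"
    unfolding Psi1_def by (intro field_differentiable_add field_differentiable_diff field_differentiable_mult
        field_differentiable_const field_differentiable_ident)
  moreover have "(\<lambda>x. Psi2 (1/2) x (1/2)) field_differentiable at x"
    unfolding Psi2_def using Psi12_range(1)[OF h(1) x h(2)]
    by (intro field_differentiable_divide field_differentiable_mult field_differentiable_const
        field_differentiable_ident z1) simp
  moreover have "(\<lambda>x. Psi3 (1/2) x (1/2)) field_differentiable at x"
    unfolding Psi3_def using denominators_pos[OF h(1) x h(2), THEN less_imp_neq, THEN not_sym]
    by (intro no_zero_divisors field_differentiable_add field_differentiable_diff field_differentiable_mult
        field_differentiable_divide field_differentiable_const field_differentiable_ident) (assumption | simp)+
  ultimately have "(\<lambda>x. a1 (Psi1 (1/2) x (1/2)) + a2 (Psi2 (1/2) x (1/2)) + a3 (Psi3 (1/2) x (1/2))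
      - b1 (1/2) - b3 (1/2)) field_differentiable at x"
    using Psi12_range[OF h(1) x h(2)] Psi3_range[OF h(1) x h(1)]
    by (intro field_differentiable_add field_differentiable_diff field_differentiable_const
        comp[of a1] comp[of a2] comp[of a3] a a3) assumption+
  then show "b2 field_differentiable at x"
    by (rule transform)
      (use x h factor_eq_inverse[of "1/2" _ "1/2"] in \<open>auto simp: algebra_simps\<close>)
qed

lemma isCont_factors:
  assumes "x \<in> {0<..<1}"
  shows "isCont a1 x" "isCont a2 x" "isCont b1 x" "isCont b2 x"
  using DERIV_isCont[OF a1[OF assms]] DERIV_isCont[OF a2[OF assms]]
    b_differentiable[OF assms, THEN field_differentiable_imp_continuous_at] by auto

text \<open>For \<open>\<epsilon>\<close> strictly between 0 and 1 this is
  \<open>b3 (Psi3 s t \<epsilon>) - a3 \<epsilon>\<close>, so it depends on \<open>s\<close> and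
  \<open>t\<close> only through \<open>Psi3 s t \<epsilon>\<close>. Written without the third
  factors it keeps its meaning at \<open>\<epsilon> = 0\<close> and \<open>\<epsilon> = 1\<close>,
  where those may be singular.\<close>

definition gap :: "real \<Rightarrow> real \<Rightarrow> real \<Rightarrow> real" where
  "gap s t \<epsilon> = a1 s + a2 t - b1 (Psi1 s t \<epsilon>) - b2 (Psi2 s t \<epsilon>)"

text \<open>At interior parameters near \<open>\<epsilon>\<close> the two gaps agree because
  \<open>level\<close> keeps \<open>Psi3\<close> fixed. The first two components stay inside the
  open unit interval up to the endpoint, so continuity carries the equality over.\<close>

lemma gap_level:
  assumes s: "s \<in> {0<..<1}" and t: "t \<in> {0<..<1}" and s': "s' \<in> {0<..<1}" and \<epsilon>01: "\<epsilon> = 0 \<or> \<epsilon> = 1"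
    and lev: "level s t s' \<epsilon> \<in> {0<..<1}"
  shows "gap s t \<epsilon> = gap s' (level s t s' \<epsilon>) \<epsilon>"
proof -
  have \<epsilon>: "\<epsilon> \<in> {0..1}" using \<epsilon>01 by auto
  define D where "D = (\<lambda>\<epsilon>. gap s t \<epsilon> - gap s' (level s t s' \<epsilon>) \<epsilon>)"
  note d = denominators_pos[OF s t \<epsilon>] denominators_pos[OF s' t \<epsilon>]
  have l: "isCont (level s t s') \<epsilon>"
    unfolding level_def using d s by (intro continuous_intros) auto
  have Z: "isCont (\<lambda>\<epsilon>. Psi1 s t \<epsilon>) \<epsilon>" "isCont (\<lambda>\<epsilon>. Psi1 s' (level s t s' \<epsilon>) \<epsilon>) \<epsilon>"
    unfolding Psi1_def by (intro continuous_intros l)+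
  have Z': "isCont (\<lambda>\<epsilon>. Psi2 s t \<epsilon>) \<epsilon>" "isCont (\<lambda>\<epsilon>. Psi2 s' (level s t s' \<epsilon>) \<epsilon>) \<epsilon>"
    unfolding Psi2_def using Psi12_range(1)[OF s t \<epsilon>] Psi12_range(1)[OF s' lev \<epsilon>]
    by (intro continuous_intros Z l; simp)+
  have "isCont D \<epsilon>"
    unfolding D_def gap_def
    by (intro continuous_intros isCont_o2[OF l] isCont_o2[OF Z(1)] isCont_o2[OF Z(2)] isCont_o2[OF Z'(1)]
       isCont_o2[OF Z'(2)] isCont_factors s t s' lev Psi12_range[OF s t \<epsilon>] Psi12_range[OF s' lev \<epsilon>])
  then have "(D \<longlongrightarrow> D \<epsilon>) (at \<epsilon> within {0<..<1})"
    using continuous_at_imp_continuous_at_within continuous_within by blast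
  moreover have "\<forall>\<^sub>F e in at \<epsilon> within {0<..<1}. D e = 0"
  proof -
    have "(level s t s' \<longlongrightarrow> level s t s' \<epsilon>) (at \<epsilon> within {0<..<1})"
      using l continuous_at_imp_continuous_at_within continuous_within by blast
    from order_tendstoD(1)[OF this, of 0] order_tendstoD(2)[OF this, of 1]
    have "\<forall>\<^sub>F e in at \<epsilon> within {0<..<1}. 0 < level s t s' e" "\<forall>\<^sub>F e in at \<epsilon> within {0<..<1}. level s t s' e < 1"
      using lev by auto
    moreover have "\<forall>\<^sub>F e in at \<epsilon> within {0<..<1}. e \<in> {0<..<1}"
      by (simp add: eventually_at_filter)
    ultimately show ?thesis
    proof eventually_elim
      case (elim e)
      then have le: "level s t s' e \<in> {0<..<1}" by simp
      from factor_eq[OF s t elim(3)] factor_eq[OF s' le elim(3)] Psi3_level[OF s t s' elim(3)]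
      show ?case by (simp add: D_def gap_def)
    qed
  qed
  then have "(D \<longlongrightarrow> 0) (at \<epsilon> within {0<..<1})" by (rule tendsto_eventually)
  moreover have "at \<epsilon> within {0<..<1} \<noteq> bot"
    using \<epsilon>01 by (auto simp: trivial_limit_within islimpt_greaterThanLessThan1 islimpt_greaterThanLessThan2)
  ultimately have "D \<epsilon> = 0" using tendsto_unique by blast
  then show ?thesis by (simp add: D_def)
qed

text \<open>At \<open>\<epsilon> = 0\<close> the first two components are just exchanged, so
  \<open>gap s t 0\<close> splits as \<open>P s + Q t\<close>, and \<open>level\<close> scales
  \<open>s\<close> and \<open>t\<close> by the same factor. The change of \<open>P\<close> under a
  scaling is thus independent of the point, which forces a logarithm, and \<open>Q\<close> must
  compensate it.\<close>

lemma first_log_difference: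
  obtains k c c' where "\<And>t. t \<in> {0<..<1} \<Longrightarrow> b2 t = a1 t - k * ln t - c"
    and "\<And>t. t \<in> {0<..<1} \<Longrightarrow> b1 t = a2 t + k * ln t - c'"
proof -
  define P where "P t = a1 t - b2 t" for t
  define Q where "Q t = a2 t - b1 t" for t
  have scale: "l * x \<in> {0<..<1}" if "l \<in> {0<..<1}" "x \<in> {0<..<1}" for l x :: real
    using that mult_strict_mono[of l 1 x 1] by simp
  have PQ: "P s - P (l * s) = Q (l * t) - Q t"
    if "s \<in> {0<..<1}" "t \<in> {0<..<1}" "l \<in> {0<..<1}" for s t l
  proof -
    have "level s t (l * s) 0 = l * t" using that by (simp add: level_def field_simps)
    then have "gap s t 0 = gap (l * s) (l * t) 0"
      using gap_level[of s t "l * s" 0] that scale by simp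
    moreover have "gap s t 0 = P s + Q t" "gap (l * s) (l * t) 0 = P (l * s) + Q (l * t)"
      using that by (simp_all add: gap_def Psi1_def Psi2_def P_def Q_def)
    ultimately show ?thesis by simp
  qed
  have dP: "(P has_real_derivative deriv P x) (at x)" if "x \<in> {0<..<1}" for x
  proof -
    have "P field_differentiable at x"
      unfolding P_def using a1[OF that] b_differentiable[OF that]
      by (intro field_differentiable_diff) (auto simp: field_differentiable_def)
    then show ?thesis using field_differentiable_derivI by blast
  qed
  \<comment> \<open>By \<open>PQ\<close> the difference \<open>P s - P (l * s)\<close> does not
    depend on \<open>s\<close>, so its derivative vanishes. Consequently
    \<open>s * deriv P s\<close> is constant, with value \<open>k\<close>.\<close>
  have scale_deriv: "deriv P s = l * deriv P (l * s)" if s: "s \<in> {0<..<1}" and l: "l \<in> {0<..<1}" for s l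
  proof -
    have "((\<lambda>s. P (l * s)) has_real_derivative deriv P (l * s) * l) (at s)"
      by (rule DERIV_chain2[where g = "(*) l", OF dP[OF scale[OF l s]] DERIV_cmult_Id])
    from DERIV_diff[OF dP[OF s] this]
    have h: "((\<lambda>s. P s - P (l * s)) has_real_derivative deriv P s - deriv P (l * s) * l) (at s)" .
    have "P x - P (l * x) = P s - P (l * s)" if "x \<in> {0<..<1}" for x
      using PQ[OF that s l] PQ[OF s s l] by simp
    from has_field_derivative_transform_within_open[OF h open_greaterThanLessThan s this]
    have "((\<lambda>x. P s - P (l * s)) has_real_derivative deriv P s - deriv P (l * s) * l) (at s)" .
    from DERIV_unique[OF this DERIV_const] show ?thesis by simp
  qed
  define k where "k = 1/2 * deriv P (1/2)"
  have euler: "s' * deriv P s' = s * deriv P s" if "0 < s'" "s' < s" "s < 1" for s s'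
    using scale_deriv[of s "s' / s"] that by (simp add: field_simps)
  have k: "deriv P s = k / s" if "s \<in> {0<..<1}" for s
  proof -
    have "s * deriv P s = k"
      using const_if_less_const[of "\<lambda>s. s * deriv P s", OF euler that] by (simp add: k_def)
    then show ?thesis using that by (simp add: field_simps)
  qed
  have "((\<lambda>s. P s - k * ln s) has_real_derivative 0) (at s)" if "s \<in> {0<..<1}" for s
  proof -
    have "((\<lambda>s. k * ln s) has_real_derivative k / s) (at s)"
      using that by (auto intro!: derivative_eq_intros)
    from DERIV_diff[OF dP[OF that] this] show ?thesis by (simp add: k[OF that])
  qed
  from const_on_unit_interval[OF this]
  have P: "P s - k * ln s = P s' - k * ln s'" if "s \<in> {0<..<1}" "s' \<in> {0<..<1}" for s s'
    using that by blast
  have Q: "Q t' + k * ln t' = Q t + k * ln t" if "0 < t'" "t' < t" "t < 1" for t t'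
  proof -
    have l: "t' / t \<in> {0<..<1}" and t: "t' / t * t = t'" "t \<in> {0<..<1}" using that by auto
    have h: "(1/2::real) \<in> {0<..<1}" by simp
    have "Q t' - Q t = P (1/2) - P (t' / t * (1/2))" using PQ[OF h t(2) l] t by simp
    also have "\<dots> = k * ln (1/2) - k * ln (t' / t * (1/2))" using P[OF h scale[OF l h]] by simp
    also have "\<dots> = k * ln t - k * ln t'" using that by (simp add: ln_mult ln_div algebra_simps)
    finally show ?thesis by simp
  qed
  show ?thesis
  proof (rule that)
    show "b2 t = a1 t - k * ln t - (P (1/2) - k * ln (1/2))" if "t \<in> {0<..<1}" for t
      using P[OF that, of "1/2"] by (simp add: P_def)
    show "b1 t = a2 t + k * ln t - (Q (1/2) + k * ln (1/2))" if "t \<in> {0<..<1}" for t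
    proof -
      have "Q t + k * ln t = Q (1/2) + k * ln (1/2)"
        by (rule const_if_less_const[of "\<lambda>t. Q t + k * ln t", OF Q that])
      then show ?thesis by (simp add: Q_def)
    qed
  qed
qed

text \<open>The coefficients \<open>m\<close>, \<open>\<sigma>\<close> and \<open>k\<close> are the
  multipliers of the logarithms of the three invariants of \<open>Psi\<close>: both sums of three
  factors are combinations of these, up to constants.\<close>

lemma log_solution:
  obtains k \<sigma> m c1 c2 c3 d1 d2 d3 where
    "\<And>t. t \<in> {0<..<1} \<Longrightarrow> a1 t = (m + k) * ln t + \<sigma> * ln (1 - t) + c1"
    "\<And>t. t \<in> {0<..<1} \<Longrightarrow> a2 t = m * ln t + \<sigma> * ln (1 - t) + c2"
    "\<And>t. t \<in> {0<..<1} \<Longrightarrow> a3 t = k * ln t + (\<sigma> - k) * ln (1 - t) + c3"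
    "\<And>t. t \<in> {0<..<1} \<Longrightarrow> b1 t = (m + k) * ln t + \<sigma> * ln (1 - t) + d1"
    "\<And>t. t \<in> {0<..<1} \<Longrightarrow> b2 t = m * ln t + \<sigma> * ln (1 - t) + d2"
    "\<And>t. t \<in> {0<..<1} \<Longrightarrow> b3 t = k * ln t + (\<sigma> - k) * ln (1 - t) + d3"
proof -
  obtain k c c' where b2: "\<And>t. t \<in> {0<..<1} \<Longrightarrow> b2 t = a1 t - k * ln t - c"
    and b1: "\<And>t. t \<in> {0<..<1} \<Longrightarrow> b1 t = a2 t + k * ln t - c'"
    using first_log_difference by blast
  \<comment> \<open>Up to a constant, \<open>e x\<close> is \<open>b2 (1 - x)\<close>. For
    \<open>s = 1 - x\<close> and \<open>t = 1 - y / (1 - x)\<close> the components at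
    \<open>\<epsilon> = 1\<close> are \<open>1 - y\<close> and \<open>1 - x / (1 - y)\<close>, which
    yields the four arguments in \<open>info\<close>.\<close>
  define e where "e x = a1 (1 - x) - k * ln (1 - x)" for x
  define \<beta> where "\<beta> x = a2 (1 - x)" for x
  have de: "(e has_real_derivative - a1' (1 - x) + k / (1 - x)) (at x)"
    and db: "(\<beta> has_real_derivative - a2' (1 - x)) (at x)" if x: "x \<in> {0<..<1}" for x
  proof -
    have x': "1 - x \<in> {0<..<1}" using x by auto
    have f: "((\<lambda>x. 1 - x) has_real_derivative -1) (at x)" by (auto intro!: derivative_eq_intros)
    have "((\<lambda>x. k * ln (1 - x)) has_real_derivative - k / (1 - x)) (at x)"
      using x by (auto intro!: derivative_eq_intros)
    from DERIV_diff[OF DERIV_chain2[where g = "\<lambda>x. 1 - x", OF a1[OF x'] f] this]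
    show "(e has_real_derivative - a1' (1 - x) + k / (1 - x)) (at x)" by (simp add: e_def[abs_def])
    from DERIV_chain2[where g = "\<lambda>x. 1 - x", OF a2[OF x'] f]
    show "(\<beta> has_real_derivative - a2' (1 - x)) (at x)" by (simp add: \<beta>_def[abs_def])
  qed
  have sub: "(\<lambda>x::real. 1 - x) ` {0<..<1} \<subseteq> {0<..<1}" by auto
  have c1: "continuous_on {0<..<1} (\<lambda>x. - a1' (1 - x) + k / (1 - x))"
    and c2: "continuous_on {0<..<1} (\<lambda>x. - a2' (1 - x))"
    by (intro continuous_intros continuous_on_compose2[OF a1' _ sub] continuous_on_compose2[OF a2' _ sub]; force)+
  have gap1: "gap (1 - x) (1 - y / (1 - x)) 1 = info e \<beta> x y + k * ln ((1 - x) / (1 - y)) + c + c'"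
    if xy: "0 < x" "0 < y" "x + y < 1" for x y
  proof -
    have Psi1: "Psi1 (1 - x) (1 - y / (1 - x)) 1 = 1 - y" 
    proof -
      define q where "q = y / (1 - x)"
      have "(1 - x) * q = y" using xy by (simp add: q_def)
      moreover have "Psi1 (1 - x) (1 - q) 1 = 1 - (1 - x) * q" by (simp add: Psi1_def algebra_simps)
      ultimately show ?thesis by (simp add: q_def)
    qed
    have Psi2: "Psi2 (1 - x) (1 - y / (1 - x)) 1 = 1 - x / (1 - y)"
    proof -
      have "(1 - x) * (1 - y / (1 - x)) = (1 - y) - x" using xy by (simp add: right_diff_distrib)
      then show ?thesis unfolding Psi2_def Psi1 using xy by (simp add: diff_divide_distrib)
    qed
    have "1 - y \<in> {0<..<1}" "1 - x / (1 - y) \<in> {0<..<1}" using xy by auto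
    then show ?thesis
      unfolding gap_def Psi1 Psi2 using xy by (simp add: b1 b2 info_def e_def \<beta>_def ln_div algebra_simps)
  qed
  \<comment> \<open>At \<open>\<epsilon> = 1\<close> two points with the same quotient
    \<open>(1 - y) / (1 - x)\<close> are related by \<open>level\<close>. The logarithm left over in
    \<open>gap1\<close> also depends on this quotient only.\<close>
  have ratio: "info e \<beta> x y = info e \<beta> x' y'"
    if xy: "0 < x" "0 < y" "x + y < 1" and xy': "0 < x'" "0 < y'" "x' + y' < 1"
      and r: "(1 - y) / (1 - x) = (1 - y') / (1 - x')" for x y x' y'
  proof -
    have r': "(1 - y) * (1 - x') = (1 - y') * (1 - x)" using r xy xy' by (simp add: field_simps)
    have "(1 - x) - (1 - x') + (1 - x') * y = (1 - x) * y'" using r' by (simp add: algebra_simps)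
    then have "level (1 - x) (1 - y / (1 - x)) (1 - x') 1 = 1 - y' / (1 - x')"
      unfolding level_def using xy xy' by (simp add: mult.commute mult.left_commute)
    moreover have "1 - y' / (1 - x') \<in> {0<..<1}" "1 - y / (1 - x) \<in> {0<..<1}" using xy xy' by auto
    ultimately have "gap (1 - x) (1 - y / (1 - x)) 1 = gap (1 - x') (1 - y' / (1 - x')) 1"
      using gap_level[of "1 - x" "1 - y / (1 - x)" "1 - x'" 1] xy xy' by simp
    moreover have "(1 - x) / (1 - y) = (1 - x') / (1 - y')" using r xy xy' by (simp add: field_simps)
    ultimately show ?thesis using gap1[OF xy] gap1[OF xy'] by simp
  qed
  obtain \<sigma> m ce cb where e: "\<And>x. x \<in> {0<..<1} \<Longrightarrow> e x = \<sigma> * ln x + m * ln (1 - x) + ce"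
    and \<beta>: "\<And>x. x \<in> {0<..<1} \<Longrightarrow> \<beta> x = \<sigma> * ln x + m * ln (1 - x) + cb"
    by (rule info_solution[OF de db c1 c2 ratio]) (assumption+, blast)
  have A1: "a1 t = (m + k) * ln t + \<sigma> * ln (1 - t) + ce" if "t \<in> {0<..<1}" for t
    using e[of "1 - t"] that by (simp add: e_def algebra_simps)
  have A2: "a2 t = m * ln t + \<sigma> * ln (1 - t) + cb" if "t \<in> {0<..<1}" for t
    using \<beta>[of "1 - t"] that by (simp add: \<beta>_def algebra_simps)
  have B1: "b1 t = (m + k) * ln t + \<sigma> * ln (1 - t) + (cb - c')" if "t \<in> {0<..<1}" for t
    using b1[OF that] A2[OF that] by (simp add: algebra_simps)
  have B2: "b2 t = m * ln t + \<sigma> * ln (1 - t) + (ce - c)" if "t \<in> {0<..<1}" for t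
    using b2[OF that] A1[OF that] by (simp add: algebra_simps)
  define L where "L t = k * ln t + (\<sigma> - k) * ln (1 - t)" for t :: real
  \<comment> \<open>The invariants remove \<open>y1\<close>, \<open>y2\<close>, \<open>z1\<close>
    and \<open>z2\<close> from the factor equation. As \<open>\<epsilon>\<close> and
    \<open>\<zeta>\<close> vary independently by \<open>Psi3_surj\<close>, both sides are
    constant.\<close>
  have third: "a3 \<epsilon> - L \<epsilon> = b3 \<zeta> - L \<zeta> - c - c'" if E: "\<epsilon> \<in> {0<..<1}" "\<zeta> \<in> {0<..<1}" for \<epsilon> \<zeta>
  proof -
    obtain y1 y2 where y: "y1 \<in> {0<..<1}" "y2 \<in> {0<..<1}" and \<zeta>: "Psi3 y1 y2 \<epsilon> = \<zeta>"
      using Psi3_surj[OF E] by blast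
    define z1 z2 where "z1 = Psi1 y1 y2 \<epsilon>" and "z2 = Psi2 y1 y2 \<epsilon>"
    have z: "z1 \<in> {0<..<1}" "z2 \<in> {0<..<1}"
      using Psi12_range[OF y, of \<epsilon>] E by (auto simp: z1_def z2_def)
    note inv = Psi_invariants[OF y E(1), folded z1_def z2_def, unfolded \<zeta>]
    have "ln z1 + ln z2 = ln y1 + ln y2"
      using arg_cong[OF inv(1), of ln] y z by (simp add: ln_mult)
    then have 1: "m * ln z1 + m * ln z2 = m * ln y1 + m * ln y2"
      by (metis distrib_left)
    have "ln (1 - z1) + ln (1 - z2) + ln (1 - \<zeta>) = ln (1 - y1) + ln (1 - y2) + ln (1 - \<epsilon>)"
      using arg_cong[OF inv(2), of ln] y z E by (simp add: ln_mult)
    then have 2: "\<sigma> * ln (1 - z1) + \<sigma> * ln (1 - z2) + \<sigma> * ln (1 - \<zeta>)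
        = \<sigma> * ln (1 - y1) + \<sigma> * ln (1 - y2) + \<sigma> * ln (1 - \<epsilon>)"
      by (metis distrib_left)
    have "ln z1 + ln \<zeta> - ln (1 - \<zeta>) = ln y1 + ln \<epsilon> - ln (1 - \<epsilon>)"
      using arg_cong[OF inv(3), of ln] y z E by (simp add: ln_mult ln_div)
    then have 3: "k * ln z1 + k * ln \<zeta> - k * ln (1 - \<zeta>) = k * ln y1 + k * ln \<epsilon> - k * ln (1 - \<epsilon>)"
      by (metis distrib_left right_diff_distrib)
    have "a1 y1 + a2 y2 + a3 \<epsilon> = b1 z1 + b2 z2 + b3 \<zeta>"
      using factor_eq[OF y E(1)] by (simp add: z1_def z2_def \<zeta>)
    then show ?thesis
      using 1 2 3 by (simp add: A1[OF y(1)] A2[OF y(2)] B1[OF z(1)] B2[OF z(2)] L_def algebra_simps)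
  qed
  show ?thesis
  proof (rule that[OF A1 A2 _ B1 B2])
    show "a3 t = k * ln t + (\<sigma> - k) * ln (1 - t) + (b3 (1/2) - L (1/2) - c - c')" if "t \<in> {0<..<1}" for t
      using third[OF that, of "1/2"] by (simp add: L_def)
    show "b3 t = k * ln t + (\<sigma> - k) * ln (1 - t) + (a3 (1/2) - L (1/2) + c + c')" if "t \<in> {0<..<1}" for t
      using third[of "1/2", OF _ that] by (simp add: L_def)
  qed
qed

end

section \<open>The invariant measure\<close>

text \<open>The Jacobian determinant of the inverse of \<open>psi 1\<close>: in the coordinates
  \<open>(x1, x2, x3)\<close> the measure with this density on \<open>cube\<close> is Lebesgue
  measure on \<open>Hset\<close>.\<close>

definition weight :: "real \<times> real \<times> real \<Rightarrow> real" where
  "weight = (\<lambda>(y1, y2, y3). y1 * (1 - y1) * (1 - y2))"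

text \<open>Agrees with \<^const>\<open>Psi\<close> on \<^const>\<open>cube\<close>, but is measurable everywhere.\<close>

definition Phi :: "real \<times> real \<times> real \<Rightarrow> real \<times> real \<times> real" where
  "Phi = (\<lambda>(y1, y2, y3). (Psi1 y1 y2 y3, Psi2 y1 y2 y3, Psi3 y1 y2 y3))"

lemma cube_iff [simp]: "(a, b, c) \<in> cube \<longleftrightarrow> a \<in> {0<..<1} \<and> b \<in> {0<..<1} \<and> c \<in> {0<..<1}"
  by (auto simp: cube_def)

lemma weight_pos: "y \<in> cube \<Longrightarrow> 0 < weight y"
  by (cases y) (simp add: weight_def)

lemma Phi_eq_Psi: "y \<in> cube \<Longrightarrow> Phi y = Psi y"
  by (cases y) (simp add: Phi_def Psi_explicit Psi1_def Psi2_def Psi3_def)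

lemma Phi_in_cube: "y \<in> cube \<Longrightarrow> Phi y \<in> cube"
proof (cases y)
  case (fields a b c)
  assume "y \<in> cube"
  then show ?thesis using Psi12_range[of a b c] Psi3_range[of a b c] fields by (auto simp: Phi_def)
qed

lemma Phi_involution: "y \<in> cube \<Longrightarrow> Phi (Phi y) = y"
proof (cases y)
  case (fields a b c)
  assume "y \<in> cube"
  then show ?thesis using Psi_involution[of a b c] fields by (simp add: Phi_def)
qed

lemma open_cube: "open cube"
  unfolding cube_def by (intro open_Times) auto

lemma cube_borel [measurable]: "cube \<in> sets borel"
  using open_cube by (rule borel_open)

lemma weight_measurable [measurable]: "weight \<in> borel_measurable borel"
  unfolding weight_def by (simp add: borel_prod[symmetric] split_beta')

lemma Phi_measurable [measurable]: "Phi \<in> borel_measurable borel"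
  unfolding Phi_def Psi1_def Psi2_def Psi3_def by (simp add: borel_prod[symmetric] split_beta' Psi1_def)

lemma Hset_borel [measurable]: "Hset \<in> sets borel"
proof -
  have "Hset = cube \<inter> {x. snd (snd x) < min (fst x * fst (snd x)) ((1 - fst x) * (1 - fst (snd x)))}"
    by (auto simp: Hset_def)
  moreover have "open \<dots>"
    by (intro open_Int open_cube open_Collect_less continuous_intros)
  ultimately have "open Hset" by simp
  then show ?thesis by (rule borel_open)
qed

lemma psi_1_measurable [measurable]: "psi 1 \<in> borel_measurable borel"
proof -
  have "psi 1 = (\<lambda>x. (fst x, (fst x * fst (snd x) - snd (snd x)) / fst x,
      snd (snd x) / ((1 - fst x) * (fst x - fst x * fst (snd x) + snd (snd x)))))"
    by (auto simp: Let_def)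
  also have "\<dots> \<in> borel_measurable borel"
    by (simp add: borel_prod[symmetric])
  finally show ?thesis .
qed

text \<open>The substitutions below run over all real \<open>x2\<close> and \<open>x3\<close>, so
  points outside \<open>Hset\<close> must be excluded as well for the indicator of
  \<open>cube\<close> to become that of \<open>Hset\<close>.\<close>

lemma psi_1_in_cube_iff:
  assumes "x1 \<in> {0<..<1}"
  shows "psi 1 (x1, x2, x3) \<in> cube \<longleftrightarrow> (x1, x2, x3) \<in> Hset"
proof
  assume c: "psi 1 (x1, x2, x3) \<in> cube"
  define y2 y3 where "y2 = (x1 * x2 - x3) / x1" and "y3 = x3 / ((1 - x1) * (x1 - x1 * x2 + x3))"
  have y: "0 < y2" "y2 < 1" "0 < y3" "y3 < 1" using c by (auto simp: Let_def y2_def y3_def)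
  have e: "x1 - x1 * x2 + x3 = x1 * (1 - y2)" using assms by (simp add: y2_def field_simps)
  have x3: "x3 = x1 * (1 - x1) * (1 - y2) * y3"
    using assms y unfolding y3_def e by simp
  have "x1 * x2 = x1 * y2 + x3" using assms by (simp add: y2_def)
  also have "\<dots> = x1 * (y2 + (1 - x1) * (1 - y2) * y3)" unfolding x3 by (simp add: algebra_simps)
  finally have x2: "x2 = y2 + (1 - x1) * (1 - y2) * y3" using assms by simp
  show "(x1, x2, x3) \<in> Hset"
    using psi_1_inverse(1)[of x1 y2 y3] assms y unfolding x2[symmetric] x3[symmetric] by simp
qed (rule psi_1_left_inverse)

section \<open>Change of variables to \<open>Hset\<close>\<close>

lemma nn_integral_lborel_triple:
  fixes f :: "real \<times> real \<times> real \<Rightarrow> ennreal"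
  assumes [measurable]: "f \<in> borel_measurable borel"
  shows "integral\<^sup>N lborel f = (\<integral>\<^sup>+x. \<integral>\<^sup>+y. \<integral>\<^sup>+z. f (x, y, z) \<partial>lborel \<partial>lborel \<partial>lborel)"
proof -
  have "(\<integral>\<^sup>+x. \<integral>\<^sup>+p. f (x, p) \<partial>lborel \<partial>lborel) = integral\<^sup>N (lborel \<Otimes>\<^sub>M lborel) f"
    by (rule lborel.nn_integral_fst) (simp add: lborel_prod)
  moreover have "(\<integral>\<^sup>+y. \<integral>\<^sup>+z. f (x, y, z) \<partial>lborel \<partial>lborel) = (\<integral>\<^sup>+p. f (x, p) \<partial>lborel)" for x
  proof -
    have "(\<integral>\<^sup>+y. \<integral>\<^sup>+z. f (x, y, z) \<partial>lborel \<partial>lborel) = integral\<^sup>N (lborel \<Otimes>\<^sub>M lborel) (\<lambda>p. f (x, p))"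
      by (rule lborel.nn_integral_fst) (simp add: lborel_prod)
    then show ?thesis by (simp add: lborel_prod)
  qed
  ultimately show ?thesis by (simp add: lborel_prod)
qed

text \<open>For fixed \<open>y1, y2\<close> the map \<open>y3 \<mapsto> x2\<close> is affine, and for fixed \<open>x1, x2\<close> so is \<open>y2 \<mapsto> x3\<close>;
  hence only Fubini's theorem and one-dimensional affine substitutions are needed.\<close>

lemma nn_integral_psi_1:
  fixes G :: "real \<times> real \<times> real \<Rightarrow> ennreal"
  assumes [measurable]: "G \<in> borel_measurable borel"
  shows "(\<integral>\<^sup>+y. indicator cube y * ennreal (weight y) * G y \<partial>lborel)
    = (\<integral>\<^sup>+x1. \<integral>\<^sup>+x2. \<integral>\<^sup>+x3. indicator Hset (x1, x2, x3) * G (psi 1 (x1, x2, x3)) \<partial>lborel \<partial>lborel \<partial>lborel)"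
proof -
  define K where "K y = indicator cube y * G y" for y
  have K [measurable]: "K \<in> borel_measurable borel" unfolding K_def by measurable
  have KP [measurable]: "K \<in> borel_measurable (borel \<Otimes>\<^sub>M borel \<Otimes>\<^sub>M borel)" using K by (simp add: borel_prod)
  define c where "c y1 y2 = (1 - y1) * (1 - y2)" for y1 y2 :: real
  have c [measurable]: "(\<lambda>(x,y). c x y) \<in> borel_measurable (borel \<Otimes>\<^sub>M borel)" unfolding c_def by measurable
  have "(\<integral>\<^sup>+y. indicator cube y * ennreal (weight y) * G y \<partial>lborel)
    = (\<integral>\<^sup>+y1. \<integral>\<^sup>+y2. \<integral>\<^sup>+y3. ennreal (weight (y1, y2, y3)) * K (y1, y2, y3) \<partial>lborel \<partial>lborel \<partial>lborel)"
    by (subst nn_integral_lborel_triple) (simp_all add: K_def mult_ac)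
  \<comment> \<open>Substitute \<open>x2 = y2 + c y1 y2 * y3\<close>. Since \<open>weight\<close>
    equals \<open>y1 * c y1 y2\<close>, the Jacobian uses up the factor \<open>c y1 y2\<close> and
    leaves \<open>y1\<close>. If \<open>y1\<close> or \<open>y2\<close> is outside the unit
    interval, \<open>K\<close> vanishes on both sides.\<close>
  also have "\<dots> = (\<integral>\<^sup>+y1. \<integral>\<^sup>+y2. \<integral>\<^sup>+x2. ennreal y1 * K (y1, y2, (x2 - y2) / c y1 y2) \<partial>lborel \<partial>lborel \<partial>lborel)"
  proof (rule nn_integral_cong, rule nn_integral_cong)
    fix y1 y2 :: real
    show "(\<integral>\<^sup>+y3. ennreal (weight (y1, y2, y3)) * K (y1, y2, y3) \<partial>lborel)
      = (\<integral>\<^sup>+x2. ennreal y1 * K (y1, y2, (x2 - y2) / c y1 y2) \<partial>lborel)"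
    proof (cases "y1 \<in> {0<..<1} \<and> y2 \<in> {0<..<1}")
      case True
      then have c0: "0 < c y1 y2" by (simp add: c_def)
      have "(\<integral>\<^sup>+x2. K (y1, y2, (x2 - y2) / c y1 y2) \<partial>lborel)
        = ennreal \<bar>c y1 y2\<bar> * (\<integral>\<^sup>+y3. K (y1, y2, ((y2 + c y1 y2 * y3) - y2) / c y1 y2) \<partial>lborel)"
        by (rule nn_integral_real_affine) (use c0 in auto)
      also have "\<dots> = ennreal (c y1 y2) * (\<integral>\<^sup>+y3. K (y1, y2, y3) \<partial>lborel)" using c0 by simp
      finally have "(\<integral>\<^sup>+x2. ennreal y1 * K (y1, y2, (x2 - y2) / c y1 y2) \<partial>lborel)
        = ennreal (y1 * c y1 y2) * (\<integral>\<^sup>+y3. K (y1, y2, y3) \<partial>lborel)"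
        using True c0 by (simp add: nn_integral_cmult ennreal_mult mult.assoc)
      also have "\<dots> = (\<integral>\<^sup>+y3. ennreal (weight (y1, y2, y3)) * K (y1, y2, y3) \<partial>lborel)"
        by (simp add: weight_def c_def nn_integral_cmult mult.assoc)
      finally show ?thesis ..
    qed (auto simp: K_def)
  qed
  also have "\<dots> = (\<integral>\<^sup>+x1. \<integral>\<^sup>+x2. \<integral>\<^sup>+y2. ennreal x1 * K (x1, y2, (x2 - y2) / c x1 y2) \<partial>lborel \<partial>lborel \<partial>lborel)"
    by (intro nn_integral_cong lborel_pair.Fubini') measurable
  also have "\<dots> = (\<integral>\<^sup>+x1. \<integral>\<^sup>+x2. \<integral>\<^sup>+x3. indicator Hset (x1, x2, x3) * G (psi 1 (x1, x2, x3)) \<partial>lborel \<partial>lborel \<partial>lborel)"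
  proof (rule nn_integral_cong, rule nn_integral_cong)
    fix x1 x2 :: real
    show "(\<integral>\<^sup>+y2. ennreal x1 * K (x1, y2, (x2 - y2) / c x1 y2) \<partial>lborel)
      = (\<integral>\<^sup>+x3. indicator Hset (x1, x2, x3) * G (psi 1 (x1, x2, x3)) \<partial>lborel)"
    proof (cases "x1 \<in> {0<..<1}")
      case True
      define L where "L y2 = ennreal x1 * K (x1, y2, (x2 - y2) / c x1 y2)" for y2
      have [measurable]: "L \<in> borel_measurable borel" unfolding L_def by measurable
      \<comment> \<open>Substitute \<open>y2 = x2 - x3 / x1\<close>; the Jacobian
        \<open>1 / x1\<close> cancels the remaining factor \<open>x1\<close>.\<close>
      have "(\<integral>\<^sup>+y2. L y2 \<partial>lborel) = ennreal \<bar>- 1 / x1\<bar> * (\<integral>\<^sup>+x3. L (x2 + (- 1 / x1) * x3) \<partial>lborel)"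
        by (rule nn_integral_real_affine) (use True in auto)
      also have "\<dots> = (\<integral>\<^sup>+x3. ennreal (1 / x1) * L (x2 + (- 1 / x1) * x3) \<partial>lborel)"
        using True by (simp add: nn_integral_cmult)
      also have "\<dots> = (\<integral>\<^sup>+x3. indicator Hset (x1, x2, x3) * G (psi 1 (x1, x2, x3)) \<partial>lborel)"
      proof (intro nn_integral_cong)
        fix x3 :: real
        have e: "psi 1 (x1, x2, x3) = (x1, x2 + (- 1 / x1) * x3, (x2 - (x2 + (- 1 / x1) * x3)) / c x1 (x2 + (- 1 / x1) * x3))"
        proof -
          have "x1 - x1 * x2 + x3 = x1 * (1 - (x2 + (- 1 / x1) * x3))" using True by (simp add: field_simps)
          then show ?thesis using True by (simp add: Let_def c_def field_simps)
        qed
        have "ennreal (1 / x1) * L (x2 + (- 1 / x1) * x3) = K (psi 1 (x1, x2, x3))"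
          unfolding e L_def using True by (simp add: mult.assoc[symmetric] ennreal_mult[symmetric])
        also have "\<dots> = indicator Hset (x1, x2, x3) * G (psi 1 (x1, x2, x3))"
          unfolding K_def using psi_1_in_cube_iff[OF True] by (simp add: indicator_def)
        finally show "ennreal (1 / x1) * L (x2 + (- 1 / x1) * x3) = \<dots>" .
      qed
      finally show ?thesis unfolding L_def .
    next
      case False
      then have H: "indicator Hset (x1, x2, x3) = (0::ennreal)" for x3 by (auto simp: Hset_def indicator_def)
      have K: "K (x1, y2, y3) = 0" for y2 y3 using False by (auto simp: K_def indicator_def)
      show ?thesis unfolding H K by simp
    qed
  qed
  finally show ?thesis .
qed

lemma Psi_psi_1:
  assumes "(x1, x2, x3) \<in> Hset"
  shows "Psi (psi 1 (x1, x2, x3)) = psi 1 (x2, x1, x3)"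
proof -
  have "inv_into Hset (psi 1) (psi 1 (x1, x2, x3)) = (x1, x2, x3)"
    using bij_betw_inv_into_left[OF bij_betw_psi_1 assms] .
  then show ?thesis by (simp add: Psi_def Let_def mult.commute)
qed

text \<open>In the coordinates \<open>(x1, x2, x3)\<close> the map \<^const>\<open>Psi\<close> just exchanges \<open>x1\<close> and \<open>x2\<close>.\<close>

lemma nn_integral_Phi_invariant:
  fixes G :: "real \<times> real \<times> real \<Rightarrow> ennreal"
  assumes G [measurable]: "G \<in> borel_measurable borel"
  shows "(\<integral>\<^sup>+y. indicator cube y * ennreal (weight y) * G (Phi y) \<partial>lborel)
    = (\<integral>\<^sup>+y. indicator cube y * ennreal (weight y) * G y \<partial>lborel)"
proof -
  define F where "F x = indicator Hset x * G (psi 1 x)" for x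
  have [measurable]: "F \<in> borel_measurable borel" unfolding F_def by measurable
  then have [measurable]: "F \<in> borel_measurable (borel \<Otimes>\<^sub>M borel \<Otimes>\<^sub>M borel)" by (simp add: borel_prod)
  have "indicator Hset (x1, x2, x3) * G (Phi (psi 1 (x1, x2, x3))) = F (x2, x1, x3)" for x1 x2 x3
  proof (cases "(x1, x2, x3) \<in> Hset")
    case True
    then have "(x2, x1, x3) \<in> Hset" by (auto simp: Hset_def mult.commute)
    then show ?thesis
      using Psi_psi_1[OF True] Phi_eq_Psi[OF psi_1_left_inverse(1)[OF True]] True by (simp add: F_def del: psi.simps)
  next
    case False
    then have "(x2, x1, x3) \<notin> Hset" by (auto simp: Hset_def mult.commute)
    then show ?thesis using False by (simp add: F_def)
  qed
  then have "(\<integral>\<^sup>+y. indicator cube y * ennreal (weight y) * G (Phi y) \<partial>lborel)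
    = (\<integral>\<^sup>+x1. \<integral>\<^sup>+x2. \<integral>\<^sup>+x3. F (x2, x1, x3) \<partial>lborel \<partial>lborel \<partial>lborel)"
    by (simp add: nn_integral_psi_1 del: psi.simps)
  also have "\<dots> = (\<integral>\<^sup>+x2. \<integral>\<^sup>+x1. \<integral>\<^sup>+x3. F (x2, x1, x3) \<partial>lborel \<partial>lborel \<partial>lborel)"
    by (intro lborel_pair.Fubini') measurable
  also have "\<dots> = (\<integral>\<^sup>+y. indicator cube y * ennreal (weight y) * G y \<partial>lborel)"
    by (simp add: nn_integral_psi_1[OF G] F_def del: psi.simps)
  finally show ?thesis .
qed

section \<open>Densities of vectors with independent components\<close>

text \<open>The quotient of \<open>f\<close> by \<open>weight\<close> is the density relative to the
  invariant measure. For the image under an involution preserving that measure it is merely composed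
  with \<open>Phi\<close>; multiplying by \<open>weight\<close> returns to Lebesgue measure.\<close>

lemma distributed_Phi:
  assumes Y: "distributed M lborel Y (\<lambda>x. ennreal (indicator cube x * f x))"
  shows "distributed M lborel (\<lambda>\<omega>. Phi (Y \<omega>))
    (\<lambda>z. ennreal (indicator cube z * (weight z * f (Phi z) / weight (Phi z))))"
proof -
  define g where "g x = ennreal (indicator cube x * f x)" for x
  have [measurable]: "g \<in> borel_measurable borel" "Y \<in> M \<rightarrow>\<^sub>M borel" and d: "distr M lborel Y = density lborel g"
    using Y by (auto simp: distributed_def g_def[abs_def])
  define G where "G y = g y * ennreal (inverse (weight y))" for y
  have [measurable]: "G \<in> borel_measurable borel" unfolding G_def by measurable
  have h: "ennreal (indicator cube z * (weight z * f (Phi z) / weight (Phi z)))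
      = indicator cube z * ennreal (weight z) * G (Phi z)" for z
  proof (cases "z \<in> cube")
    case True
    then have "0 < weight z" "0 < weight (Phi z)" "Phi z \<in> cube" using weight_pos Phi_in_cube by auto
    then show ?thesis
      using True by (simp add: G_def g_def ennreal_mult'[symmetric] ennreal_mult''[symmetric] divide_inverse mult.assoc)
  qed simp
  \<comment> \<open>Inserting \<open>Phi (Phi y) = y\<close> makes the integrand below a function of
    \<open>Phi y\<close>, as invariance requires.\<close>
  have gG: "g y = indicator cube y * ennreal (weight y) * G (Phi (Phi y))" for y
  proof (cases "y \<in> cube")
    case True
    have e: "weight y * (f y * inverse (weight y)) = f y" using weight_pos[OF True] by simp
    then show ?thesis
      using True weight_pos[OF True] by (simp add: G_def g_def e Phi_involution ennreal_mult'[symmetric] ennreal_mult''[symmetric])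
  qed (simp add: g_def)
  have "distr M lborel (\<lambda>\<omega>. Phi (Y \<omega>)) = distr (distr M lborel Y) lborel Phi"
    by (subst distr_distr) (auto simp: comp_def)
  also have "\<dots> = density lborel (\<lambda>z. indicator cube z * ennreal (weight z) * G (Phi z))"
  proof (rule measure_eqI)
    fix A assume "A \<in> sets (distr (distr M lborel Y) lborel Phi)"
    then have [measurable]: "A \<in> sets borel" by simp
    have "emeasure (distr (distr M lborel Y) lborel Phi) A = (\<integral>\<^sup>+y. g y * indicator A (Phi y) \<partial>lborel)"
    proof -
      have "Phi -` A \<in> sets borel" using measurable_sets_borel[OF Phi_measurable] by simp
      then show ?thesis
        unfolding d by (simp add: emeasure_distr emeasure_density indicator_def)
    qed
    also have "\<dots> = (\<integral>\<^sup>+y. indicator cube y * ennreal (weight y) * (G (Phi (Phi y)) * indicator A (Phi y)) \<partial>lborel)"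
      by (subst gG) (simp add: mult.assoc)
    also have "\<dots> = (\<integral>\<^sup>+y. indicator cube y * ennreal (weight y) * (G (Phi y) * indicator A y) \<partial>lborel)"
      by (rule nn_integral_Phi_invariant) measurable
    also have "\<dots> = emeasure (density lborel (\<lambda>z. indicator cube z * ennreal (weight z) * G (Phi z))) A"
      by (simp add: emeasure_density mult.assoc)
    finally show "emeasure (distr (distr M lborel Y) lborel Phi) A
      = emeasure (density lborel (\<lambda>z. indicator cube z * ennreal (weight z) * G (Phi z))) A" .
  qed simp
  finally show ?thesis unfolding distributed_def h by simp
qed

text \<open>At a point of continuity the density is the limit of averages over shrinking boxes, here
  of volume \<open>8 * \<epsilon>^3\<close>. This recovers its values at individual points from
  probabilities.\<close>

lemma tendsto_box_average:
  fixes h :: "real \<times> real \<times> real \<Rightarrow> real"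
  assumes V: "distributed M lborel V (\<lambda>x. ennreal (indicator U x * h x))"
    and U: "open U" "(a, b, c) \<in> U" and h: "continuous_on U h" "0 < h (a, b, c)"
  shows "((\<lambda>\<epsilon>. measure M (V -` ({a-\<epsilon><..<a+\<epsilon>} \<times> {b-\<epsilon><..<b+\<epsilon>} \<times> {c-\<epsilon><..<c+\<epsilon>}) \<inter> space M) / (8 * \<epsilon>^3))
    \<longlongrightarrow> h (a, b, c)) (at_right 0)"
proof (rule tendstoI)
  let ?x = "(a, b, c)"
  define B where "B \<epsilon> = {a-\<epsilon><..<a+\<epsilon>} \<times> {b-\<epsilon><..<b+\<epsilon>} \<times> {c-\<epsilon><..<c+\<epsilon>}" for \<epsilon>
  define g where "g x = ennreal (indicator U x * h x)" for x
  have [measurable]: "g \<in> borel_measurable borel" "V \<in> M \<rightarrow>\<^sub>M borel" and d: "distr M lborel V = density lborel g"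
    using V by (auto simp: distributed_def g_def[abs_def])
  have B [measurable]: "B \<epsilon> \<in> sets borel" for \<epsilon>
    unfolding B_def by (intro borel_open open_Times) auto
  have times: "emeasure lborel (A \<times> D) = emeasure lborel A * emeasure lborel D"
    if "A \<in> sets borel" "D \<in> sets borel" for A :: "real set" and D :: "'b::euclidean_space set"
    using lborel.emeasure_pair_measure_Times[of A lborel D] that by (simp add: lborel_prod)
  have vol: "emeasure lborel (B \<epsilon>) = ennreal (8 * \<epsilon>^3)" if "0 < \<epsilon>" for \<epsilon>
  proof -
    have "emeasure lborel (B \<epsilon>) = ennreal (2 * \<epsilon>) * (ennreal (2 * \<epsilon>) * ennreal (2 * \<epsilon>))"
      unfolding B_def using that by (subst times; (subst times)?; simp add: borel_open open_Times)
    also have "\<dots> = ennreal (8 * \<epsilon>^3)"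
      using that by (simp add: ennreal_mult[symmetric] power3_eq_cube)
    finally show ?thesis .
  qed
  fix \<delta> :: real assume "0 < \<delta>"
  \<comment> \<open>The minimum with \<open>h ?x\<close> keeps \<open>h ?x - \<eta>\<close>
    nonnegative, so that the lower bound can be multiplied out in \<open>ennreal\<close>.\<close>
  define \<eta> where "\<eta> = min (\<delta> / 2) (h ?x)"
  have \<eta>: "0 < \<eta>" "\<eta> < \<delta>" "\<eta> \<le> h ?x" using \<open>0 < \<delta>\<close> h(2) by (auto simp: \<eta>_def)
  have "isCont h ?x" using h(1) U continuous_on_eq_continuous_at by blast
  then obtain r1 where r1: "0 < r1" "\<And>y. dist y ?x < r1 \<Longrightarrow> dist (h y) (h ?x) < \<eta>"
    using \<eta>(1) unfolding continuous_at_eps_delta by blast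
  obtain r2 where r2: "0 < r2" "ball ?x r2 \<subseteq> U" using U openE by blast
  \<comment> \<open>A third, because the distance is estimated by the sum of three coordinate
    distances.\<close>
  define r where "r = min r1 r2 / 3"
  have r: "0 < r" using r1(1) r2(1) by (simp add: r_def)
  have near: "y \<in> U \<and> \<bar>h y - h ?x\<bar> < \<eta>" if "y \<in> B \<epsilon>" "\<epsilon> < r" for y \<epsilon>
  proof -
    obtain p q s where y: "y = (p, q, s)" by (cases y)
    have "dist y ?x \<le> \<bar>p - a\<bar> + (\<bar>q - b\<bar> + \<bar>s - c\<bar>)"
    proof -
      have "dist y ?x \<le> dist p a + dist (q, s) (b, c)"
        unfolding y dist_Pair_Pair[of p "(q, s)"] by (rule sqrt_sum_squares_le_sum) auto
      also have "dist (q, s) (b, c) \<le> dist q b + dist s c"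
        unfolding dist_Pair_Pair by (rule sqrt_sum_squares_le_sum) auto
      finally show ?thesis by (simp add: dist_real_def)
    qed
    also have "\<dots> < min r1 r2" using that by (auto simp: B_def y r_def)
    finally have "dist y ?x < r1" "dist y ?x < r2" by auto
    then show ?thesis using r1(2)[of y] r2(2) by (auto simp: dist_real_def dist_commute)
  qed
  have "dist (measure M (V -` B \<epsilon> \<inter> space M) / (8 * \<epsilon>^3)) (h ?x) < \<delta>" if \<epsilon>: "0 < \<epsilon>" "\<epsilon> < r" for \<epsilon>
  proof -
    have "emeasure M (V -` B \<epsilon> \<inter> space M) = emeasure (distr M lborel V) (B \<epsilon>)"
      by (simp add: emeasure_distr)
    also have "\<dots> = (\<integral>\<^sup>+y. g y * indicator (B \<epsilon>) y \<partial>lborel)"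
      unfolding d by (simp add: emeasure_density)
    finally have E: "emeasure M (V -` B \<epsilon> \<inter> space M) = (\<integral>\<^sup>+y. g y * indicator (B \<epsilon>) y \<partial>lborel)" .
    have v: "0 < 8 * \<epsilon>^3" using \<epsilon> by simp
    have "(\<integral>\<^sup>+y. g y * indicator (B \<epsilon>) y \<partial>lborel) \<le> (\<integral>\<^sup>+y. ennreal (h ?x + \<eta>) * indicator (B \<epsilon>) y \<partial>lborel)"
    proof (rule nn_integral_mono)
      fix y show "g y * indicator (B \<epsilon>) y \<le> ennreal (h ?x + \<eta>) * indicator (B \<epsilon>) y"
        using near[of y \<epsilon>] \<epsilon> by (auto simp: g_def split: split_indicator intro!: ennreal_leI)
    qed
    also have "\<dots> = ennreal ((h ?x + \<eta>) * (8 * \<epsilon>^3))"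
      using h(2) \<eta>(1) v by (simp add: nn_integral_cmult_indicator vol[OF \<epsilon>(1)] ennreal_mult)
    finally have u: "emeasure M (V -` B \<epsilon> \<inter> space M) \<le> ennreal ((h ?x + \<eta>) * (8 * \<epsilon>^3))" using E by simp
    have "ennreal ((h ?x - \<eta>) * (8 * \<epsilon>^3)) = (\<integral>\<^sup>+y. ennreal (h ?x - \<eta>) * indicator (B \<epsilon>) y \<partial>lborel)"
      using \<eta>(3) v by (simp add: nn_integral_cmult_indicator vol[OF \<epsilon>(1)] ennreal_mult)
    also have "\<dots> \<le> (\<integral>\<^sup>+y. g y * indicator (B \<epsilon>) y \<partial>lborel)"
    proof (rule nn_integral_mono)
      fix y show "ennreal (h ?x - \<eta>) * indicator (B \<epsilon>) y \<le> g y * indicator (B \<epsilon>) y"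
        using near[of y \<epsilon>] \<epsilon> by (auto simp: g_def split: split_indicator intro!: ennreal_leI)
    qed
    finally have l: "ennreal ((h ?x - \<eta>) * (8 * \<epsilon>^3)) \<le> emeasure M (V -` B \<epsilon> \<inter> space M)" using E by simp
    have fin: "emeasure M (V -` B \<epsilon> \<inter> space M) = ennreal (measure M (V -` B \<epsilon> \<inter> space M))"
      using u by (intro emeasure_eq_ennreal_measure) (auto simp: top_unique)
    have "measure M (V -` B \<epsilon> \<inter> space M) \<le> (h ?x + \<eta>) * (8 * \<epsilon>^3)"
      using u unfolding fin using h(2) \<eta>(1) v by (subst (asm) ennreal_le_iff) auto
    moreover have "(h ?x - \<eta>) * (8 * \<epsilon>^3) \<le> measure M (V -` B \<epsilon> \<inter> space M)"
      using l unfolding fin by (subst (asm) ennreal_le_iff) auto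
    ultimately have "\<bar>measure M (V -` B \<epsilon> \<inter> space M) / (8 * \<epsilon>^3) - h ?x\<bar> \<le> \<eta>"
      using v by (simp add: abs_le_iff pos_divide_le_eq pos_le_divide_eq left_diff_distrib distrib_right) (simp add: field_simps)
    then show ?thesis using \<eta>(2) by (simp add: dist_real_def)
  qed
  then show "\<forall>\<^sub>F \<epsilon> in at_right 0. dist (measure M (V -` ({a-\<epsilon><..<a+\<epsilon>} \<times> {b-\<epsilon><..<b+\<epsilon>} \<times> {c-\<epsilon><..<c+\<epsilon>}) \<inter> space M) / (8 * \<epsilon>^3)) (h ?x) < \<delta>"
    using r unfolding B_def by (auto simp: eventually_at_right intro!: exI[of _ r])
qed

text \<open>Box probabilities are products of marginal probabilities, and both sides involve the
  same marginal intervals with the same multiplicities. So the identity is exact for box averages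
  and passes to the limit at every point, not only almost everywhere. It expresses a product form
  without marginal densities.\<close>

lemma indep_density_factorises:
  fixes h :: "real \<times> real \<times> real \<Rightarrow> real"
  assumes "prob_space M"
    and V: "distributed M lborel V (\<lambda>x. ennreal (indicator cube x * h x))"
    and h: "continuous_on cube h" "\<And>x. x \<in> cube \<Longrightarrow> 0 < h x"
    and ind: "prob_space.indep_vars M (\<lambda>_. borel) (\<lambda>i \<omega>. coord i (V \<omega>)) {1, 2, 3}"
    and abc: "(a, b, c) \<in> cube" and pqs: "(p, q, s) \<in> cube"
  shows "h (a, b, c) * (h (p, q, s) * h (p, q, s)) = h (a, q, s) * h (p, b, s) * h (p, q, c)"
proof -
  interpret prob_space M by fact
  define m where "m i A = prob ((\<lambda>\<omega>. coord i (V \<omega>)) -` A \<inter> space M)" for i A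
  have box: "prob (V -` (A \<times> B \<times> C) \<inter> space M) = m 1 A * m 2 B * m 3 C"
    if "A \<in> sets borel" "B \<in> sets borel" "C \<in> sets borel" for A B C
  proof -
    define S where "S i = (if i = 1 then A else if i = 2 then B else C)" for i :: nat
    have "V -` (A \<times> B \<times> C) \<inter> space M = (\<Inter>i\<in>{1, 2, 3}. (\<lambda>\<omega>. coord i (V \<omega>)) -` S i \<inter> space M)"
    proof -
      have "V \<omega> \<in> A \<times> B \<times> C \<longleftrightarrow> coord 1 (V \<omega>) \<in> A \<and> coord 2 (V \<omega>) \<in> B \<and> coord 3 (V \<omega>) \<in> C" for \<omega>
        by (cases "V \<omega>") simp
      then show ?thesis by (auto simp: S_def)
    qed
    also have "prob \<dots> = (\<Prod>i\<in>{1, 2, 3}. prob ((\<lambda>\<omega>. coord i (V \<omega>)) -` S i \<inter> space M))"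
      by (rule indep_varsD[OF ind]) (use that in \<open>auto simp: S_def\<close>)
    finally show ?thesis by (simp add: m_def S_def)
  qed
  define Q where "Q \<epsilon> x y z = prob (V -` ({x-\<epsilon><..<x+\<epsilon>} \<times> {y-\<epsilon><..<y+\<epsilon>} \<times> {z-\<epsilon><..<z+\<epsilon>}) \<inter> space M) / (8 * \<epsilon>^3)"
    for \<epsilon> x y z
  have lim: "((\<lambda>\<epsilon>. Q \<epsilon> x y z) \<longlongrightarrow> h (x, y, z)) (at_right 0)" if "(x, y, z) \<in> cube" for x y z
    unfolding Q_def by (rule tendsto_box_average[OF V open_cube that h(1) h(2)[OF that]])
  have "Q \<epsilon> a b c * (Q \<epsilon> p q s * Q \<epsilon> p q s) = Q \<epsilon> a q s * Q \<epsilon> p b s * Q \<epsilon> p q c" for \<epsilon>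
    unfolding Q_def by (simp add: box)
  then have "((\<lambda>\<epsilon>. Q \<epsilon> a q s * Q \<epsilon> p b s * Q \<epsilon> p q c) \<longlongrightarrow> h (a, b, c) * (h (p, q, s) * h (p, q, s))) (at_right 0)"
    using tendsto_mult[OF lim[OF abc] tendsto_mult[OF lim[OF pqs] lim[OF pqs]]] by simp
  moreover have "((\<lambda>\<epsilon>. Q \<epsilon> a q s * Q \<epsilon> p b s * Q \<epsilon> p q c) \<longlongrightarrow> h (a, q, s) * h (p, b, s) * h (p, q, c)) (at_right 0)"
    using abc pqs by (intro tendsto_mult lim) auto
  ultimately show ?thesis using tendsto_unique trivial_limit_at_right_real by blast
qed

section \<open>Beta distributions\<close>

text \<open>The unnormalised beta density, for arbitrary real parameters: their positivity is
  deduced only later, from finite total mass.\<close>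

definition beta_kernel :: "real \<Rightarrow> real \<Rightarrow> real \<Rightarrow> real" where
  "beta_kernel a b x = (if x \<in> {0<..<1} then x powr (a - 1) * (1 - x) powr (b - 1) else 0)"

lemma beta_kernel_measurable [measurable]: "beta_kernel a b \<in> borel_measurable borel"
  unfolding beta_kernel_def by measurable

lemma beta_kernel_nonneg: "0 \<le> beta_kernel a b x"
  by (simp add: beta_kernel_def)

lemma nn_integral_beta_kernel_swap:
  "(\<integral>\<^sup>+x. ennreal (beta_kernel b a x) \<partial>lborel) = (\<integral>\<^sup>+x. ennreal (beta_kernel a b x) \<partial>lborel)"
proof -
  have "beta_kernel b a x = beta_kernel a b (1 + (- 1) * x)" for x
    by (simp add: beta_kernel_def mult.commute)
  then show ?thesis
    using nn_integral_real_affine[of "\<lambda>x. ennreal (beta_kernel a b x)" "-1" 1] by simp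
qed

text \<open>If \<open>a\<close> were at most 0, the kernel would dominate a positive multiple of
  \<open>1 / x\<close> near 0, whose integral diverges logarithmically.\<close>

lemma beta_kernel_exponent_pos:
  assumes fin: "(\<integral>\<^sup>+x. ennreal (beta_kernel a b x) \<partial>lborel) \<noteq> \<infinity>"
  shows "0 < a"
proof (rule ccontr)
  assume "\<not> 0 < a"
  then have a: "a \<le> 0" by simp
  \<comment> \<open>A lower bound for \<open>(1 - x) powr (b - 1)\<close> on \<open>(0, 1/2]\<close>
    that covers both signs of \<open>b - 1\<close>.\<close>
  define c where "c = min 1 ((1/2) powr (b - 1))"
  have c: "0 < c" by (simp add: c_def)
  have lower: "c / x \<le> beta_kernel a b x" if x: "0 < x" "x \<le> 1/2" for x
  proof -
    have "c \<le> (1 - x) powr (b - 1)"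
    proof (cases "0 \<le> b - 1")
      case True
      then have "(1/2) powr (b - 1) \<le> (1 - x) powr (b - 1)" using x by (intro powr_mono2) auto
      then show ?thesis by (simp add: c_def)
    next
      case False
      then have "1 powr (b - 1) \<le> (1 - x) powr (b - 1)" using x by (intro powr_mono2') auto
      then show ?thesis by (simp add: c_def)
    qed
    moreover have "x powr (- 1) \<le> x powr (a - 1)" using a x by (intro powr_mono') auto
    ultimately have "c * x powr (- 1) \<le> (1 - x) powr (b - 1) * x powr (a - 1)"
      using c by (intro mult_mono) auto
    then show ?thesis using x by (simp add: beta_kernel_def powr_minus_divide mult.commute)
  qed
  have "ennreal (c * n) \<le> (\<integral>\<^sup>+x. ennreal (beta_kernel a b x) \<partial>lborel)" if n: "0 \<le> n" for n :: real
  proof -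
    \<comment> \<open>Chosen so that \<open>1 / x\<close> integrates to exactly \<open>n\<close>
      over \<open>{\<delta>..1/2}\<close>.\<close>
    define \<delta> where "\<delta> = exp (- n) / 2"
    have \<delta>: "0 < \<delta>" "\<delta> \<le> 1/2" using n by (auto simp: \<delta>_def)
    have "(\<integral>\<^sup>+x. ennreal (c / x) * indicator {\<delta>..1/2} x \<partial>lborel) = ennreal (c * ln (1/2) - c * ln \<delta>)"
    proof (rule nn_integral_FTC_Icc)
      show "((\<lambda>x. c * ln x) has_real_derivative c / x) (at x)" if "x \<in> {\<delta>..1/2}" for x
        using that \<delta> by (auto intro!: derivative_eq_intros)
    qed (use \<delta> c in auto)
    also have "c * ln (1/2) - c * ln \<delta> = c * n"
      by (simp add: \<delta>_def ln_div algebra_simps)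
    finally have "ennreal (c * n) = (\<integral>\<^sup>+x. ennreal (c / x) * indicator {\<delta>..1/2} x \<partial>lborel)" ..
    also have "\<dots> \<le> (\<integral>\<^sup>+x. ennreal (beta_kernel a b x) \<partial>lborel)"
      using lower \<delta> by (intro nn_integral_mono) (auto split: split_indicator intro!: ennreal_leI)
    finally show ?thesis .
  qed
  note unbounded = this
  obtain I where I: "0 \<le> I" "(\<integral>\<^sup>+x. ennreal (beta_kernel a b x) \<partial>lborel) = ennreal I"
    using fin by (cases "(\<integral>\<^sup>+x. ennreal (beta_kernel a b x) \<partial>lborel)") auto
  have "ennreal (c * ((I + 1) / c)) \<le> ennreal I"
    using unbounded[of "(I + 1) / c"] I c by simp
  then show False using c I by simp
qed

lemma nn_integral_beta_density:
  assumes "0 < a" "0 < b"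
  shows "(\<integral>\<^sup>+x. ennreal (beta_density a b x) \<partial>lborel) = 1"
proof -
  have B: "0 < Beta a b" using assms by (simp add: Beta_def Gamma_real_pos)
  have "((\<lambda>t. t powr (a - 1) * (1 - t) powr (b - 1) / Beta a b) has_integral Beta a b / Beta a b) {0<..<1}"
    using has_integral_Beta_real[OF assms] by (intro has_integral_divide) (simp add: has_integral_Icc_iff_Ioo)
  then have "((\<lambda>t. if t \<in> {0<..<1} then t powr (a - 1) * (1 - t) powr (b - 1) / Beta a b else 0)
      has_integral Beta a b / Beta a b) UNIV"
    by (simp only: has_integral_restrict_UNIV)
  then have "(beta_density a b has_integral 1) UNIV"
    using B by (simp add: beta_density_def[abs_def])
  then show ?thesis
    using B by (subst nn_integral_has_integral_lborel) (auto simp: beta_density_def[abs_def])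
qed

lemma beta_density_kernel: "beta_density a b x = beta_kernel a b x / Beta a b"
  by (simp add: beta_density_def beta_kernel_def)

lemma beta_density_measurable [measurable]: "beta_density a b \<in> borel_measurable borel"
  unfolding beta_density_kernel[abs_def] by measurable

lemma prob_space_beta_measure:
  assumes "0 < a" "0 < b"
  shows "prob_space (beta_measure a b)"
proof (rule prob_spaceI)
  show "emeasure (beta_measure a b) (space (beta_measure a b)) = 1"
    unfolding beta_measure_def using nn_integral_beta_density[OF assms] by (simp add: emeasure_density)
qed

lemma density_lborel_pair:
  fixes f :: "'a::euclidean_space \<Rightarrow> ennreal" and g :: "'b::euclidean_space \<Rightarrow> ennreal"
  assumes "f \<in> borel_measurable borel" "g \<in> borel_measurable borel"
    and "sigma_finite_measure (density lborel g)"
  shows "density lborel f \<Otimes>\<^sub>M density lborel g = density lborel (\<lambda>(x, y). f x * g y)"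
  using pair_measure_density[of f lborel g lborel] assms lborel.sigma_finite_measure_axioms
  by (simp add: lborel_prod)

lemma beta_measure_product:
  assumes "0 < a" "0 < b" "0 < c" "0 < d" "0 < e" "0 < f"
  shows "beta_measure a b \<Otimes>\<^sub>M (beta_measure c d \<Otimes>\<^sub>M beta_measure e f)
    = density lborel (\<lambda>(x, y, z). ennreal (beta_density a b x) * (ennreal (beta_density c d y) * ennreal (beta_density e f z)))"
proof -
  define g where "g = (\<lambda>(y, z). ennreal (beta_density c d y) * ennreal (beta_density e f z))"
  have "g \<in> borel_measurable (borel \<Otimes>\<^sub>M borel)" unfolding g_def by measurable
  then have g: "g \<in> borel_measurable borel" by (simp only: borel_prod)
  interpret P1: prob_space "beta_measure c d" using assms by (simp add: prob_space_beta_measure)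
  interpret P2: prob_space "beta_measure e f" using assms by (simp add: prob_space_beta_measure)
  interpret P: pair_prob_space "beta_measure c d" "beta_measure e f" ..
  have 1: "beta_measure c d \<Otimes>\<^sub>M beta_measure e f = density lborel g"
    unfolding g_def beta_measure_def
    by (rule density_lborel_pair)
      (use P2.sigma_finite_measure_axioms in \<open>simp_all add: beta_measure_def\<close>)
  have "sigma_finite_measure (density lborel g)"
    using P.sigma_finite_measure_axioms unfolding 1 .
  then show ?thesis
    unfolding 1 unfolding beta_measure_def
    by (subst density_lborel_pair) (use g in \<open>simp_all add: g_def case_prod_unfold\<close>)
qed

text \<open>Total mass 1 is used twice: first it makes all three one-dimensional integrals finite,
  hence the parameters positive; then, with the beta functions available for normalisation, it fixes
  the remaining constant.\<close>

lemma beta_product_identification: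
  fixes h :: "real \<times> real \<times> real \<Rightarrow> real"
  assumes "prob_space M"
    and V: "distributed M lborel V (\<lambda>x. ennreal (indicator cube x * h x))"
    and C: "0 < C"
    and h: "\<And>x y z. (x, y, z) \<in> cube \<Longrightarrow> h (x, y, z) = C * (beta_kernel a b x * (beta_kernel c d y * beta_kernel e f z))"
  shows "0 < a" "0 < b" "0 < c" "0 < d" "0 < e" "0 < f"
    and "distr M borel V = beta_measure a b \<Otimes>\<^sub>M (beta_measure c d \<Otimes>\<^sub>M beta_measure e f)"
proof -
  interpret prob_space M by fact
  have [measurable]: "V \<in> M \<rightarrow>\<^sub>M borel" and d: "distr M lborel V = density lborel (\<lambda>x. ennreal (indicator cube x * h x))"
    and [measurable]: "(\<lambda>x. ennreal (indicator cube x * h x)) \<in> borel_measurable borel"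
    using V by (auto simp: distributed_def)
  define I where "I a b = (\<integral>\<^sup>+x. ennreal (beta_kernel a b x) \<partial>lborel)" for a b
  have H: "ennreal (indicator cube (x, y, z) * h (x, y, z))
    = ennreal C * (ennreal (beta_kernel a b x) * (ennreal (beta_kernel c d y) * ennreal (beta_kernel e f z)))" for x y z
  proof (cases "(x, y, z) \<in> cube")
    case True
    then show ?thesis using C by (simp add: h ennreal_mult beta_kernel_nonneg)
  next
    case False
    then have "beta_kernel a b x = 0 \<or> beta_kernel c d y = 0 \<or> beta_kernel e f z = 0"
      by (auto simp: beta_kernel_def)
    then show ?thesis using False by auto
  qed
  have "emeasure (distr M lborel V) UNIV = 1"
    using emeasure_space_1 by (simp add: emeasure_distr)
  then have "(\<integral>\<^sup>+x. ennreal (indicator cube x * h x) \<partial>lborel) = 1"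
    unfolding d by (simp add: emeasure_density)
  then have tot: "ennreal C * (I a b * (I c d * I e f)) = 1"
    by (simp add: nn_integral_lborel_triple H nn_integral_cmult nn_integral_multc I_def mult.assoc)
  \<comment> \<open>A product in \<open>ennreal\<close> with an infinite factor is either infinite
    or 0, never 1.\<close>
  have "I a b \<noteq> \<infinity>" "I c d \<noteq> \<infinity>" "I e f \<noteq> \<infinity>"
    using tot C by (auto simp: ennreal_top_mult ennreal_mult_top split: if_splits)
  then show pos: "0 < a" "0 < b" "0 < c" "0 < d" "0 < e" "0 < f"
    using beta_kernel_exponent_pos nn_integral_beta_kernel_swap unfolding I_def by metis+
  define D where "D = C * (Beta a b * (Beta c d * Beta e f))"
  have B: "0 < Beta a b" "0 < Beta c d" "0 < Beta e f" using pos by (simp_all add: Beta_def Gamma_real_pos)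
  have D: "0 < D" using B C by (simp add: D_def)
  have H': "ennreal (indicator cube (x, y, z) * h (x, y, z))
    = ennreal D * (ennreal (beta_density a b x) * (ennreal (beta_density c d y) * ennreal (beta_density e f z)))" for x y z
  proof -
    have "C * (beta_kernel a b x * (beta_kernel c d y * beta_kernel e f z))
      = D * (beta_density a b x * (beta_density c d y * beta_density e f z))"
      using B by (simp add: D_def beta_density_kernel)
    moreover have "0 \<le> beta_density a' b' x" if "0 < Beta a' b'" for a' b' x
      using that by (simp add: beta_density_kernel beta_kernel_nonneg)
    ultimately show ?thesis
      unfolding H using B C D by (simp add: ennreal_mult[symmetric] beta_kernel_nonneg)
  qed
  have "(\<integral>\<^sup>+x. ennreal (indicator cube x * h x) \<partial>lborel) = ennreal D"
    by (simp add: nn_integral_lborel_triple H' nn_integral_cmult nn_integral_multc nn_integral_beta_density pos)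
  then have "D = 1" using \<open>(\<integral>\<^sup>+x. ennreal (indicator cube x * h x) \<partial>lborel) = 1\<close> by simp
  then have "(\<lambda>x. ennreal (indicator cube x * h x))
    = (\<lambda>(x, y, z). ennreal (beta_density a b x) * (ennreal (beta_density c d y) * ennreal (beta_density e f z)))"
    using H' by auto
  then have "distr M lborel V = beta_measure a b \<Otimes>\<^sub>M (beta_measure c d \<Otimes>\<^sub>M beta_measure e f)"
    unfolding d beta_measure_product[OF pos] by simp
  moreover have "distr M borel V = distr M lborel V" by (rule distr_cong) auto
  ultimately show "distr M borel V = beta_measure a b \<Otimes>\<^sub>M (beta_measure c d \<Otimes>\<^sub>M beta_measure e f)" by simp
qed

section \<open>The characterisation\<close>

text \<open>Applied below to the axis-parallel lines through the centre of \<open>cube\<close>, on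
  which the factors of a product density can be read off up to constants.\<close>

lemma C1_on_line:
  assumes "C1_on S f"
  obtains g where "\<And>x. p + x *\<^sub>R v \<in> S \<Longrightarrow> ((\<lambda>x. f (p + x *\<^sub>R v)) has_real_derivative g x) (at x)"
    and "continuous_on {x. p + x *\<^sub>R v \<in> S} g"
proof -
  obtain F where F: "\<And>x. x \<in> S \<Longrightarrow> (f has_derivative blinfun_apply (F x)) (at x)" "continuous_on S F"
    using assms unfolding C1_on_def by blast
  show ?thesis
  proof (rule that[of "\<lambda>x. blinfun_apply (F (p + x *\<^sub>R v)) v"])
    fix x assume x: "p + x *\<^sub>R v \<in> S"
    have "((\<lambda>x. p + x *\<^sub>R v) has_derivative (\<lambda>t. t *\<^sub>R v)) (at x)"
      by (auto intro!: derivative_eq_intros)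
    from has_derivative_compose[OF this F(1)[OF x]]
    show "((\<lambda>x. f (p + x *\<^sub>R v)) has_real_derivative blinfun_apply (F (p + x *\<^sub>R v)) v) (at x)"
      by (simp add: has_field_derivative_def blinfun.scaleR_right mult_commute_abs)
  next
    show "continuous_on {x. p + x *\<^sub>R v \<in> S} (\<lambda>x. blinfun_apply (F (p + x *\<^sub>R v)) v)"
      by (intro continuous_intros continuous_on_compose2[OF F(2)]) auto
  qed
qed

lemma C1_on_imp_continuous_on:
  assumes "C1_on S f"
  shows "continuous_on S f"
proof -
  obtain F where "\<And>x. x \<in> S \<Longrightarrow> (f has_derivative blinfun_apply (F x)) (at x)"
    using assms unfolding C1_on_def by blast
  then show ?thesis
    by (meson continuous_at_imp_continuous_on has_derivative_continuous)
qed

lemma continuous_on_Phi: "continuous_on cube Phi"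
proof -
  have Psi1: "continuous_on cube (\<lambda>y. Psi1 (fst y) (fst (snd y)) (snd (snd y)))"
    unfolding Psi1_def by (intro continuous_intros)
  have Psi2: "continuous_on cube (\<lambda>y. Psi2 (fst y) (fst (snd y)) (snd (snd y)))"
    unfolding Psi2_def
  proof (intro continuous_intros Psi1 ballI)
    fix y assume "y \<in> cube"
    then show "Psi1 (fst y) (fst (snd y)) (snd (snd y)) \<noteq> 0"
      using Psi12_range(1)[of "fst y" "fst (snd y)" "snd (snd y)"] by (cases y) auto
  qed
  have Psi3: "continuous_on cube (\<lambda>y. Psi3 (fst y) (fst (snd y)) (snd (snd y)))"
    unfolding Psi3_def
  proof (intro continuous_intros ballI)
    fix y assume "y \<in> cube"
    then show "(1 - (1 - fst y) * snd (snd y)) * (fst (snd y) + snd (snd y) * (1 - fst (snd y))) \<noteq> 0"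
      using denominators_pos[of "fst y" "fst (snd y)" "snd (snd y)"] by (cases y) auto
  qed
  show ?thesis
    unfolding Phi_def split_beta' by (intro continuous_intros Psi1 Psi2 Psi3)
qed

lemma continuous_on_weight: "continuous_on S weight"
  unfolding weight_def split_beta' by (intro continuous_intros)

section \<open>From the densities to the factor equation and back\<close>

text \<open>Relative to \<open>weight\<close>, the relation between \<open>f\<close> and
  \<open>h\<close> is the factor equation for the logarithms of their restrictions to three lines
  through the centre. Its solution has the same exponents for both densities, so the two products
  differ only in the constants \<open>c\<close> and \<open>d\<close>.\<close>

lemma log_density_form:
  fixes f h :: "real \<times> real \<times> real \<Rightarrow> real"
  assumes f: "C1_on cube f" "\<And>x. x \<in> cube \<Longrightarrow> 0 < f x"
    and h: "\<And>z. z \<in> cube \<Longrightarrow> h z = weight z * f (Phi z) / weight (Phi z)"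
    and ff: "\<And>a b c. (a, b, c) \<in> cube \<Longrightarrow>
      f (a, b, c) * (f (1/2, 1/2, 1/2) * f (1/2, 1/2, 1/2)) = f (a, 1/2, 1/2) * f (1/2, b, 1/2) * f (1/2, 1/2, c)"
    and hh: "\<And>a b c. (a, b, c) \<in> cube \<Longrightarrow>
      h (a, b, c) * (h (1/2, 1/2, 1/2) * h (1/2, 1/2, 1/2)) = h (a, 1/2, 1/2) * h (1/2, b, 1/2) * h (1/2, 1/2, c)"
  obtains p q r c d where
    "\<And>x y z. (x, y, z) \<in> cube \<Longrightarrow> f (x, y, z) = exp c * (beta_kernel (p + r) (q + r) x * (beta_kernel p (q + r) y * beta_kernel r q z))"
    "\<And>x y z. (x, y, z) \<in> cube \<Longrightarrow> h (x, y, z) = exp d * (beta_kernel (p + r) (q + r) x * (beta_kernel p (q + r) y * beta_kernel r q z))"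
proof -
  have hpos: "0 < h z" if "z \<in> cube" for z
    using h[OF that] weight_pos[OF that] weight_pos[OF Phi_in_cube[OF that]] f(2)[OF Phi_in_cube[OF that]] by simp
  \<comment> \<open>The subtracted terms make up \<open>ln (weight (a, b, c))\<close>, which is
    \<open>ln a + ln (1 - a) + ln (1 - b)\<close>; the constant from the centre of the cube is
    charged to \<open>A3\<close>.\<close>
  define A1 where "A1 g x = ln (g (x, 1/2, 1/2)) - ln x - ln (1 - x)" for g :: "real \<times> real \<times> real \<Rightarrow> real" and x
  define A2 where "A2 g x = ln (g (1/2, x, 1/2)) - ln (1 - x)" for g :: "real \<times> real \<times> real \<Rightarrow> real" and x
  define A3 where "A3 g x = ln (g (1/2, 1/2, x)) - 2 * ln (g (1/2, 1/2, 1/2))" for g :: "real \<times> real \<times> real \<Rightarrow> real" and x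
  have split: "ln (g (a, b, c)) = A1 g a + A2 g b + A3 g c + ln (weight (a, b, c))"
    if g: "\<And>x. x \<in> cube \<Longrightarrow> 0 < g x" and abc: "(a, b, c) \<in> cube"
      and gg: "g (a, b, c) * (g (1/2, 1/2, 1/2) * g (1/2, 1/2, 1/2)) = g (a, 1/2, 1/2) * g (1/2, b, 1/2) * g (1/2, 1/2, c)"
    for g a b c
  proof -
    have "(a, 1/2, 1/2) \<in> cube" "(1/2, b, 1/2) \<in> cube" "(1/2, 1/2, c) \<in> cube" "(1/2, 1/2, 1/2) \<in> cube"
      using abc by auto
    then have P: "0 < g (a, b, c)" "0 < g (a, 1/2, 1/2)" "0 < g (1/2, b, 1/2)" "0 < g (1/2, 1/2, c)" "0 < g (1/2, 1/2, 1/2)"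
      using g abc by blast+
    have "ln (g (a, b, c)) + (ln (g (1/2, 1/2, 1/2)) + ln (g (1/2, 1/2, 1/2)))
        = ln (g (a, 1/2, 1/2)) + ln (g (1/2, b, 1/2)) + ln (g (1/2, 1/2, c))"
      using arg_cong[OF gg, of ln] P by (simp add: ln_mult_pos)
    moreover have "ln (weight (a, b, c)) = ln a + ln (1 - a) + ln (1 - b)"
      using abc by (simp add: weight_def ln_mult_pos)
    ultimately show ?thesis by (simp add: A1_def A2_def A3_def)
  qed
  have line: "\<exists>g. (\<forall>x\<in>{0<..<1}. ((\<lambda>x. f (e x)) has_real_derivative g x) (at x)) \<and> continuous_on {0<..<1} g"
    if "\<And>x. e x = P + x *\<^sub>R v" "\<And>x. x \<in> {0<..<1} \<Longrightarrow> e x \<in> cube" for e P v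
  proof -
    obtain g where g: "\<And>x. P + x *\<^sub>R v \<in> cube \<Longrightarrow> ((\<lambda>x. f (P + x *\<^sub>R v)) has_real_derivative g x) (at x)"
      "continuous_on {x. P + x *\<^sub>R v \<in> cube} g" by (rule C1_on_line[OF f(1)]) blast
    show ?thesis
    proof (intro exI[of _ g] conjI ballI)
      show "((\<lambda>x. f (e x)) has_real_derivative g x) (at x)" if "x \<in> {0<..<1}" for x
        using g(1)[of x] \<open>\<And>x. x \<in> {0<..<1} \<Longrightarrow> e x \<in> cube\<close>[OF that] unfolding \<open>\<And>x. e x = P + x *\<^sub>R v\<close> .
      show "continuous_on {0<..<1} g"
        by (rule continuous_on_subset[OF g(2)]) (use that in auto)
    qed
  qed
  have "\<exists>g. (\<forall>x\<in>{0<..<1}. ((\<lambda>x. f (x, 1/2, 1/2)) has_real_derivative g x) (at x)) \<and> continuous_on {0<..<1} g"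
    by (rule line[of _ "(0, 1/2, 1/2)" "(1, 0, 0)"]) auto
  then obtain g1 where g1: "\<And>x. x \<in> {0<..<1} \<Longrightarrow> ((\<lambda>x. f (x, 1/2, 1/2)) has_real_derivative g1 x) (at x)" "continuous_on {0<..<1} g1"
    by blast
  have "\<exists>g. (\<forall>x\<in>{0<..<1}. ((\<lambda>x. f (1/2, x, 1/2)) has_real_derivative g x) (at x)) \<and> continuous_on {0<..<1} g"
    by (rule line[of _ "(1/2, 0, 1/2)" "(0, 1, 0)"]) auto
  then obtain g2 where g2: "\<And>x. x \<in> {0<..<1} \<Longrightarrow> ((\<lambda>x. f (1/2, x, 1/2)) has_real_derivative g2 x) (at x)" "continuous_on {0<..<1} g2"
    by blast
  have "\<exists>g. (\<forall>x\<in>{0<..<1}. ((\<lambda>x. f (1/2, 1/2, x)) has_real_derivative g x) (at x)) \<and> continuous_on {0<..<1} g"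
    by (rule line[of _ "(1/2, 1/2, 0)" "(0, 0, 1)"]) auto
  then obtain g3 where g3: "\<And>x. x \<in> {0<..<1} \<Longrightarrow> ((\<lambda>x. f (1/2, 1/2, x)) has_real_derivative g3 x) (at x)"
    by blast
  have pos: "0 < f (x, 1/2, 1/2)" "0 < f (1/2, x, 1/2)" "0 < f (1/2, 1/2, x)" if "x \<in> {0<..<1}" for x
    using f(2) that by auto
  have lnd: "((\<lambda>x. ln (g x)) has_real_derivative D / g x) (at x)"
    if "(g has_real_derivative D) (at x)" "0 < g x" for g D and x :: real
    using DERIV_chain2[OF DERIV_ln_divide[OF that(2)] that(1)] by simp
  have ln1: "((\<lambda>x::real. ln (1 - x)) has_real_derivative - 1 / (1 - x)) (at x)" if "x < 1" for x :: real
    using that by (auto intro!: derivative_eq_intros)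
  interpret factor_equation "A1 f" "A2 f" "A3 f" "A1 h" "A2 h" "A3 h"
    "\<lambda>x. g1 x / f (x, 1/2, 1/2) - 1 / x - (- 1 / (1 - x))" "\<lambda>x. g2 x / f (1/2, x, 1/2) - (- 1 / (1 - x))"
  proof
    fix x :: real assume x: "x \<in> {0<..<1}"
    then have x': "0 < x" "x < 1" by auto
    show "(A1 f has_real_derivative g1 x / f (x, 1/2, 1/2) - 1 / x - (- 1 / (1 - x))) (at x)"
      unfolding A1_def
      by (rule DERIV_diff[OF DERIV_diff[OF lnd[OF g1(1)[OF x] pos(1)[OF x]] DERIV_ln_divide[OF x'(1)]] ln1[OF x'(2)]])
    show "(A2 f has_real_derivative g2 x / f (1/2, x, 1/2) - (- 1 / (1 - x))) (at x)"
      unfolding A2_def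
      by (rule DERIV_diff[OF lnd[OF g2(1)[OF x] pos(2)[OF x]] ln1[OF x'(2)]])
    show "A3 f field_differentiable at x"
      unfolding A3_def field_differentiable_def
      using DERIV_diff[OF lnd[OF g3(1)[OF x] pos(3)[OF x]] DERIV_const] by blast
  next
    have c: "continuous_on {0<..<1} (\<lambda>x. f (x, 1/2, 1/2))" "continuous_on {0<..<1} (\<lambda>x. f (1/2, x, 1/2))"
      using DERIV_isCont[OF g1(1)] DERIV_isCont[OF g2(1)] by (blast intro: continuous_at_imp_continuous_on)+
    show "continuous_on {0<..<1} (\<lambda>x. g1 x / f (x, 1/2, 1/2) - 1 / x - (- 1 / (1 - x)))"
      using pos(1) by (intro continuous_intros c g1(2)) (auto simp: less_imp_neq[THEN not_sym])
    show "continuous_on {0<..<1} (\<lambda>x. g2 x / f (1/2, x, 1/2) - (- 1 / (1 - x)))"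
      using pos(2) by (intro continuous_intros c g2(2)) (auto simp: less_imp_neq[THEN not_sym])
  next
    fix y1 y2 y3 :: real assume y: "y1 \<in> {0<..<1}" "y2 \<in> {0<..<1}" "y3 \<in> {0<..<1}"
    then have Y: "(y1, y2, y3) \<in> cube" by simp
    note Z = Phi_in_cube[OF Y]
    have z: "Phi (y1, y2, y3) = (Psi1 y1 y2 y3, Psi2 y1 y2 y3, Psi3 y1 y2 y3)" by (simp add: Phi_def)
    \<comment> \<open>The formula for \<open>h\<close> is used at \<open>Phi y\<close>: by the
      involution, \<open>h\<close> over \<open>weight\<close> there equals \<open>f\<close> over
      \<open>weight\<close> at \<open>y\<close>.\<close>
    have "h (Phi (y1, y2, y3)) = weight (Phi (y1, y2, y3)) * f (y1, y2, y3) / weight (y1, y2, y3)"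
      using h[OF Z] Phi_involution[OF Y] by simp
    then have "ln (h (Phi (y1, y2, y3))) = ln (weight (Phi (y1, y2, y3))) + ln (f (y1, y2, y3)) - ln (weight (y1, y2, y3))"
      using weight_pos[OF Y] weight_pos[OF Z] f(2)[OF Y] by (simp add: ln_mult_pos ln_div)
    moreover have "ln (f (y1, y2, y3)) = A1 f y1 + A2 f y2 + A3 f y3 + ln (weight (y1, y2, y3))"
      by (rule split[OF f(2) Y ff[OF Y]])
    moreover have "ln (h (Phi (y1, y2, y3))) = A1 h (Psi1 y1 y2 y3) + A2 h (Psi2 y1 y2 y3) + A3 h (Psi3 y1 y2 y3) + ln (weight (Phi (y1, y2, y3)))"
      using split[OF hpos Z[unfolded z] hh[OF Z[unfolded z]]] unfolding z .
    ultimately show "A1 f y1 + A2 f y2 + A3 f y3 = A1 h (Psi1 y1 y2 y3) + A2 h (Psi2 y1 y2 y3) + A3 h (Psi3 y1 y2 y3)"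
      by linarith
  qed
  obtain k \<sigma> m c1 c2 c3 d1 d2 d3 where sol:
    "\<And>t. t \<in> {0<..<1} \<Longrightarrow> A1 f t = (m + k) * ln t + \<sigma> * ln (1 - t) + c1"
    "\<And>t. t \<in> {0<..<1} \<Longrightarrow> A2 f t = m * ln t + \<sigma> * ln (1 - t) + c2"
    "\<And>t. t \<in> {0<..<1} \<Longrightarrow> A3 f t = k * ln t + (\<sigma> - k) * ln (1 - t) + c3"
    "\<And>t. t \<in> {0<..<1} \<Longrightarrow> A1 h t = (m + k) * ln t + \<sigma> * ln (1 - t) + d1"
    "\<And>t. t \<in> {0<..<1} \<Longrightarrow> A2 h t = m * ln t + \<sigma> * ln (1 - t) + d2"
    "\<And>t. t \<in> {0<..<1} \<Longrightarrow> A3 h t = k * ln t + (\<sigma> - k) * ln (1 - t) + d3"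
    by (rule log_solution) blast
  \<comment> \<open>Restoring \<open>weight\<close> gives the exponents \<open>m + k + 1\<close>,
    \<open>\<sigma> + 1\<close>, \<open>m\<close>, \<open>\<sigma> + 1\<close>, \<open>k\<close>,
    \<open>\<sigma> - k\<close>. They must be one less than \<open>p + r\<close>,
    \<open>q + r\<close>, \<open>p\<close>, \<open>q + r\<close>, \<open>r\<close>,
    \<open>q\<close>.\<close>
  define p q r where "p = m + 1" and "q = \<sigma> - k + 1" and "r = k + 1"
  have form: "g (x, y, z) = exp (e1 + e2 + e3) * (beta_kernel (p + r) (q + r) x * (beta_kernel p (q + r) y * beta_kernel r q z))"
    if g: "0 < g (x, y, z)" and xyz: "(x, y, z) \<in> cube"
      and l: "ln (g (x, y, z)) = A1 g x + A2 g y + A3 g z + ln (weight (x, y, z))"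
      and 1: "A1 g x = (m + k) * ln x + \<sigma> * ln (1 - x) + e1"
      and 2: "A2 g y = m * ln y + \<sigma> * ln (1 - y) + e2"
      and 3: "A3 g z = k * ln z + (\<sigma> - k) * ln (1 - z) + e3"
    for g x y z e1 e2 e3
  proof -
    have u: "0 < x" "x < 1" "0 < y" "y < 1" "0 < z" "z < 1" using xyz by auto
    have "ln (weight (x, y, z)) = ln x + ln (1 - x) + ln (1 - y)"
      using u by (simp add: weight_def ln_mult_pos)
    then have L: "ln (g (x, y, z)) = (e1 + e2 + e3) + (((p + r - 1) * ln x + (q + r - 1) * ln (1 - x))
        + (((p - 1) * ln y + (q + r - 1) * ln (1 - y)) + ((r - 1) * ln z + (q - 1) * ln (1 - z))))"
      unfolding l 1 2 3 p_def q_def r_def by (simp add: algebra_simps)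
    have "g (x, y, z) = exp (ln (g (x, y, z)))" using g by simp
    also have "\<dots> = exp (e1 + e2 + e3) * (beta_kernel (p + r) (q + r) x * (beta_kernel p (q + r) y * beta_kernel r q z))"
      unfolding L exp_add using u by (simp add: beta_kernel_def powr_def)
    finally show ?thesis .
  qed
  show ?thesis
  proof (rule that)
    show "f (x, y, z) = exp (c1 + c2 + c3) * (beta_kernel (p + r) (q + r) x * (beta_kernel p (q + r) y * beta_kernel r q z))"
      if "(x, y, z) \<in> cube" for x y z
      using that by (intro form split f(2) ff sol) auto
    show "h (x, y, z) = exp (d1 + d2 + d3) * (beta_kernel (p + r) (q + r) x * (beta_kernel p (q + r) y * beta_kernel r q z))"
      if "(x, y, z) \<in> cube" for x y z
      using that by (intro form split hpos hh sol) auto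
  qed
qed

theorem theorem2:
  fixes M :: "'a measure"
    and Y Z :: "'a \<Rightarrow> real \<times> real \<times> real"
    and f :: "real \<times> real \<times> real \<Rightarrow> real"
  assumes "prob_space M"
    and "\<And>\<omega>. \<omega> \<in> space M \<Longrightarrow> Y \<omega> \<in> cube"
    and "distributed M lborel Y (\<lambda>x. ennreal (indicator cube x * f x))"
    and "\<And>x. x \<in> cube \<Longrightarrow> f x > 0"
    and "C1_on cube f"
    and "prob_space.indep_vars M (\<lambda>_. borel) (\<lambda>i \<omega>. coord i (Y \<omega>)) {1, 2, 3}"
    and "\<And>\<omega>. Z \<omega> = Psi (Y \<omega>)"
    and "prob_space.indep_vars M (\<lambda>_. borel) (\<lambda>i \<omega>. coord i (Z \<omega>)) {1, 2, 3}"
  shows "\<exists>p q r :: real. p > 0 \<and> q > 0 \<and> r > 0 \<and>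
    distr M borel Y = distr M borel Z \<and>
    distr M borel Z =
      beta_measure (p + r) (q + r) \<Otimes>\<^sub>M (beta_measure p (q + r) \<Otimes>\<^sub>M beta_measure r q)"
proof -
  define h where "h z = weight z * f (Phi z) / weight (Phi z)" for z
  have Z: "Z \<omega> = Phi (Y \<omega>)" if "\<omega> \<in> space M" for \<omega>
    using assms(2)[OF that] assms(7) Phi_eq_Psi by simp
  have dZ: "distributed M lborel Z (\<lambda>x. ennreal (indicator cube x * h x))"
  proof -
    have "distr M lborel Z = distr M lborel (\<lambda>\<omega>. Phi (Y \<omega>))" by (rule distr_cong) (auto simp: Z)
    moreover have "Z \<in> M \<rightarrow>\<^sub>M lborel \<longleftrightarrow> (\<lambda>\<omega>. Phi (Y \<omega>)) \<in> M \<rightarrow>\<^sub>M lborel"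
      by (rule measurable_cong) (rule Z)
    ultimately show ?thesis
      using distributed_Phi[OF assms(3)] unfolding distributed_def h_def by simp
  qed
  have fc: "continuous_on cube f" by (rule C1_on_imp_continuous_on[OF assms(5)])
  have hpos: "0 < h z" if "z \<in> cube" for z
    unfolding h_def using weight_pos[OF that] weight_pos[OF Phi_in_cube[OF that]] assms(4)[OF Phi_in_cube[OF that]] by simp
  \<comment> \<open>Continuity of \<open>h\<close> lets the pointwise factorisation apply to
    \<open>Z\<close> as well.\<close>
  have hc: "continuous_on cube h"
    unfolding h_def
    by (intro continuous_intros continuous_on_weight continuous_on_compose2[OF fc continuous_on_Phi]
        continuous_on_compose2[OF continuous_on_weight[of UNIV] continuous_on_Phi])
      (use Phi_in_cube weight_pos in \<open>auto simp: less_imp_neq[THEN not_sym]\<close>)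
  have half: "(1/2, 1/2, 1/2) \<in> cube" by simp
  obtain p q r c d where
    F: "\<And>x y z. (x, y, z) \<in> cube \<Longrightarrow> f (x, y, z) = exp c * (beta_kernel (p + r) (q + r) x * (beta_kernel p (q + r) y * beta_kernel r q z))"
    and H: "\<And>x y z. (x, y, z) \<in> cube \<Longrightarrow> h (x, y, z) = exp d * (beta_kernel (p + r) (q + r) x * (beta_kernel p (q + r) y * beta_kernel r q z))"
    by (rule log_density_form[OF assms(5,4) h_def indep_density_factorises[OF assms(1,3) fc assms(4,6) _ half]
          indep_density_factorises[OF assms(1) dZ hc hpos assms(8) _ half]]) (assumption+, blast)
  note Y' = beta_product_identification[OF assms(1,3) exp_gt_zero F]
    and Z' = beta_product_identification[OF assms(1) dZ exp_gt_zero H]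
  show ?thesis
    \<comment> \<open>The facts 3, 5 and 6 are the positivity of \<open>p\<close>, \<open>r\<close>
      and \<open>q\<close>. Both laws are the same product measure, since normalisation has removed
      \<open>exp c\<close> and \<open>exp d\<close>.\<close>
    using Y'(3,5,6,7) Z'(7) by metis
qed

end
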